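(* Let $R_4=\mathbb Z[a,b,c,d,d^{-1}]$ and let $H_4$ be the quotient of the group algebra $R_4B_3$ of the braid group $B_3=\langle s_1,s_2\mid s_1s_2s_1=s_2s_1s_2\rangle$ by the relations $s_i^4=as_i^3+bs_i^2+cs_i+d$, $i=1,2$. Then $H_4$ is a free $R_4$-module of rank $96$. Therefore the BMR freeness conjecture holds for the exceptional group $G_8$, i.e. the generic Hecke algebra of $G_8$ is a free module of rank $|G_8|=96$ over its ring of definition.
   Context: $G_8=B_3/\langle s_1^4,s_2^4\rangle$ has order $96$. Its generic Hecke algebra is the quotient of the group algebra of $B_3$ over the ring $\tilde R_4=\mathbb Z[u_1^{\pm1},u_2^{\pm1},u_3^{\pm1},u_4^{\pm1}]$ by the relations $(s_i-u_1)(s_i-u_2)(s_i-u_3)(s_i-u_4)=0$, $i=1,2$. *)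

theory Defs
  imports Complex_Main "HOL-Library.Poly_Mapping" "HOL-Library.Product_Plus" "HOL-Library.Cardinality"
begin

section \<open>The braid group on three strands and the group \<open>G\<^sub>8\<close>\<close>

datatype gen = S1 | S2

text \<open>In a word, \<open>(g, True)\<close> stands for the generator \<open>g\<close> and \<open>(g, False)\<close> for its inverse.\<close>

type_synonym word = "(gen \<times> bool) list"

inductive braid_cong :: "word \<Rightarrow> word \<Rightarrow> bool" where
  refl: "braid_cong v v"
| sym: "braid_cong v w \<Longrightarrow> braid_cong w v"
| trans: "braid_cong u v \<Longrightarrow> braid_cong v w \<Longrightarrow> braid_cong u w"
| append: "braid_cong v v' \<Longrightarrow> braid_cong w w' \<Longrightarrow> braid_cong (v @ w) (v' @ w')"
| cancel: "braid_cong [(g, e), (g, \<not> e)] []"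
| braid: "braid_cong [(S1, True), (S2, True), (S1, True)] [(S2, True), (S1, True), (S2, True)]"

lemma braid_cong_equivp: "equivp braid_cong"
  by (intro equivpI reflpI sympI transpI) (blast intro: braid_cong.intros)+

quotient_type B3 = word / braid_cong
  by (rule braid_cong_equivp)

definition word_inv :: "word \<Rightarrow> word" where
  "word_inv w = map (\<lambda>(g, e). (g, \<not> e)) (rev w)"

lemma word_inv_simps [simp]:
  "word_inv [] = []" "word_inv (v @ w) = word_inv w @ word_inv v"
  "word_inv ((g, e) # w) = word_inv w @ [(g, \<not> e)]"
  by (auto simp: word_inv_def)

lemma word_inv_left: "braid_cong (word_inv w @ w) []"
proof (induction w)
  case Nil
  show ?case by (simp add: braid_cong.refl)
next
  case (Cons x w)
  obtain g e where x: "x = (g, e)" by fastforce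
  have "braid_cong ([(g, \<not> e)] @ [(g, e)]) []"
    using braid_cong.cancel[of g "\<not> e"] by simp
  from braid_cong.append[OF braid_cong.refl[of "word_inv w"] braid_cong.append[OF this braid_cong.refl[of w]]]
  have "braid_cong (word_inv (x # w) @ x # w) (word_inv w @ w)" by (simp add: x)
  with Cons.IH show ?case by (blast intro: braid_cong.trans)
qed

lemma word_inv_right: "braid_cong (w @ word_inv w) []"
proof -
  have "word_inv (word_inv w) = w" by (induction w) auto
  with word_inv_left[of "word_inv w"] show ?thesis by simp
qed

lemma word_inv_cong: "braid_cong v w \<Longrightarrow> braid_cong (word_inv v) (word_inv w)"
proof -
  assume vw: "braid_cong v w"
  have 1: "braid_cong (word_inv v @ (w @ word_inv w)) (word_inv v @ [])"
    by (intro braid_cong.append braid_cong.refl word_inv_right)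
  have 2: "braid_cong ((word_inv v @ v) @ word_inv w) ([] @ word_inv w)"
    by (intro braid_cong.append braid_cong.refl word_inv_left)
  have 3: "braid_cong (word_inv v @ (v @ word_inv w)) (word_inv v @ (w @ word_inv w))"
    by (intro braid_cong.append braid_cong.refl vw)
  from 1 2 3 show ?thesis
    by (metis append.assoc append_Nil append_Nil2 braid_cong.sym braid_cong.trans)
qed

text \<open>The group operation of \<open>B3\<close> is written additively (without being commutative), because
  the convolution product of \<^theory>\<open>HOL-Library.Poly_Mapping\<close> is indexed by additive monoids.\<close>

instantiation B3 :: group_add
begin

lift_definition zero_B3 :: B3 is "[]" .
lift_definition plus_B3 :: "B3 \<Rightarrow> B3 \<Rightarrow> B3" is "(@)" by (rule braid_cong.append)
lift_definition uminus_B3 :: "B3 \<Rightarrow> B3" is word_inv by (rule word_inv_cong)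
definition minus_B3 :: "B3 \<Rightarrow> B3 \<Rightarrow> B3" where "minus_B3 x y = x + - y"

instance
proof
  fix a b c :: B3
  show "a + b + c = a + (b + c)" by transfer (simp add: braid_cong.refl)
  show "0 + a = a" by transfer (simp add: braid_cong.refl)
  show "a + 0 = a" by transfer (simp add: braid_cong.refl)
  show "- a + a = 0" by transfer (rule word_inv_left)
  show "a + - b = a - b" by (simp add: minus_B3_def)
qed

end

lift_definition braid_gen :: "gen \<Rightarrow> B3" is "\<lambda>g. [(g, True)]" .

inductive_set normal_closure :: "'a::group_add set \<Rightarrow> 'a set" for X where
  incl: "x \<in> X \<Longrightarrow> x \<in> normal_closure X"
| zero: "0 \<in> normal_closure X"
| plus: "x \<in> normal_closure X \<Longrightarrow> y \<in> normal_closure X \<Longrightarrow> x + y \<in> normal_closure X"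
| uminus: "x \<in> normal_closure X \<Longrightarrow> - x \<in> normal_closure X"
| conj: "x \<in> normal_closure X \<Longrightarrow> g + x + - g \<in> normal_closure X"

definition G8_cong :: "B3 \<Rightarrow> B3 \<Rightarrow> bool" where
  "G8_cong x y \<longleftrightarrow>
     - x + y \<in> normal_closure (range (\<lambda>g. braid_gen g + braid_gen g + braid_gen g + braid_gen g))"

lemma G8_cong_equivp: "equivp G8_cong"
proof (intro equivpI reflpI sympI transpI)
  fix x y z :: B3
  show "G8_cong x x" by (simp add: G8_cong_def normal_closure.zero)
  show "G8_cong y x" if "G8_cong x y"
    using normal_closure.uminus[OF that[unfolded G8_cong_def]]
    by (simp add: G8_cong_def minus_add)
  show "G8_cong x z" if "G8_cong x y" "G8_cong y z"
    using normal_closure.plus[OF that[unfolded G8_cong_def]]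
    by (simp add: G8_cong_def add.assoc)
qed

quotient_type G8 = B3 / G8_cong
  by (rule G8_cong_equivp)

instantiation G8 :: group_add
begin

lift_definition zero_G8 :: G8 is 0 .

lift_definition plus_G8 :: "G8 \<Rightarrow> G8 \<Rightarrow> G8" is "(+)"
proof -
  fix x x' y y' :: B3
  assume "G8_cong x x'" "G8_cong y y'"
  from normal_closure.plus[OF normal_closure.conj[OF this(1)[unfolded G8_cong_def], of "- y"]
    this(2)[unfolded G8_cong_def]]
  show "G8_cong (x + y) (x' + y')"
    by (simp add: G8_cong_def minus_add add.assoc del: add_uminus_conv_diff)
qed

lift_definition uminus_G8 :: "G8 \<Rightarrow> G8" is uminus
proof -
  fix x y :: B3
  assume "G8_cong x y"
  from normal_closure.uminus[OF normal_closure.conj[OF this[unfolded G8_cong_def], of x]]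
  show "G8_cong (- x) (- y)"
    by (simp add: G8_cong_def minus_add add.assoc)
qed

definition minus_G8 :: "G8 \<Rightarrow> G8 \<Rightarrow> G8" where "minus_G8 x y = x + - y"

instance
proof
  have eq: "G8_cong x y" if "x = y" for x y
    using that equivp_reflp[OF G8_cong_equivp] by simp
  fix a b c :: G8
  show "a + b + c = a + (b + c)" by transfer (rule eq, simp add: add.assoc)
  show "0 + a = a" by transfer (rule eq, simp)
  show "a + 0 = a" by transfer (rule eq, simp)
  show "- a + a = 0" by transfer (rule eq, simp)
  show "a + - b = a - b" by (simp add: minus_G8_def)
qed

end


section \<open>Quotients of the group algebra\<close>

text \<open>The group algebra of \<open>B3\<close> over \<open>'r\<close> is the type \<open>B3 \<Rightarrow>\<^sub>0 'r\<close> of finitely supported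
  functions, with convolution as multiplication.\<close>

definition alg_const :: "'r::comm_ring_1 \<Rightarrow> B3 \<Rightarrow>\<^sub>0 'r" where
  "alg_const r = Poly_Mapping.single 0 r"

definition alg_gen :: "gen \<Rightarrow> B3 \<Rightarrow>\<^sub>0 'r::comm_ring_1" where
  "alg_gen g = Poly_Mapping.single (braid_gen g) 1"

lemma alg_const_simps:
  "alg_const (r + r') = alg_const r + alg_const r'"
  "alg_const (r * r') = alg_const r * alg_const r'"
  "alg_const 0 = 0" "alg_const 1 = 1"
  by (simp_all add: alg_const_def single_add mult_single)

inductive_set ideal_gen :: "'a::ring_1 set \<Rightarrow> 'a set" for X where
  incl: "x \<in> X \<Longrightarrow> x \<in> ideal_gen X"
| zero: "0 \<in> ideal_gen X"
| plus: "x \<in> ideal_gen X \<Longrightarrow> y \<in> ideal_gen X \<Longrightarrow> x + y \<in> ideal_gen X"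
| left: "x \<in> ideal_gen X \<Longrightarrow> a * x \<in> ideal_gen X"
| right: "x \<in> ideal_gen X \<Longrightarrow> x * a \<in> ideal_gen X"

definition ideal_cong :: "'a::ring_1 set \<Rightarrow> 'a \<Rightarrow> 'a \<Rightarrow> bool" where
  "ideal_cong X x y \<longleftrightarrow> x - y \<in> ideal_gen X"

lemma ideal_cong_refl: "ideal_cong X x x"
  by (simp add: ideal_cong_def ideal_gen.zero)

lemma ideal_cong_uminus: "ideal_cong X x y \<Longrightarrow> ideal_cong X (- x) (- y)"
  using ideal_gen.left[of "x - y" X "- 1"] by (simp add: ideal_cong_def)

lemma ideal_cong_plus:
  "ideal_cong X x x' \<Longrightarrow> ideal_cong X y y' \<Longrightarrow> ideal_cong X (x + y) (x' + y')"
  using ideal_gen.plus[of "x - x'" X "y - y'"] by (simp add: ideal_cong_def algebra_simps)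

lemma ideal_cong_minus:
  "ideal_cong X x x' \<Longrightarrow> ideal_cong X y y' \<Longrightarrow> ideal_cong X (x - y) (x' - y')"
  using ideal_cong_plus[OF _ ideal_cong_uminus, of X x x' y y'] by simp

lemma ideal_cong_times:
  "ideal_cong X x x' \<Longrightarrow> ideal_cong X y y' \<Longrightarrow> ideal_cong X (x * y) (x' * y')"
  using ideal_gen.plus[OF ideal_gen.right[of "x - x'" X y] ideal_gen.left[of "y - y'" X x']]
  by (simp add: ideal_cong_def algebra_simps)

lemma ideal_cong_equivp: "equivp (ideal_cong X)"
proof (intro equivpI reflpI sympI transpI)
  fix x y z
  show "ideal_cong X x x" by (rule ideal_cong_refl)
  show "ideal_cong X y x" if "ideal_cong X x y"
    using ideal_cong_uminus[OF that] by (simp add: ideal_cong_def)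
  show "ideal_cong X x z" if "ideal_cong X x y" "ideal_cong X y z"
    using ideal_gen.plus[OF that[unfolded ideal_cong_def]] by (simp add: ideal_cong_def)
qed

definition (in module) free_of_rank :: "nat \<Rightarrow> bool" where
  "free_of_rank n \<longleftrightarrow> (\<exists>B. finite B \<and> card B = n \<and> independent B \<and> span B = UNIV)"


section \<open>The algebra \<open>H\<^sub>4\<close>\<close>

text \<open>\<open>\<int>[a, b, c, d, d\<^sup>-\<^sup>1]\<close> is the monoid ring of \<open>\<nat>\<^sup>3 \<times> \<int>\<close>, the monoid of exponents of the
  monomials in \<open>a, b, c, d\<close>.\<close>

type_synonym R4 = "(nat \<times> nat \<times> nat \<times> int) \<Rightarrow>\<^sub>0 int"

definition R4_a :: R4 where "R4_a = Poly_Mapping.single (1, 0, 0, 0) 1"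
definition R4_b :: R4 where "R4_b = Poly_Mapping.single (0, 1, 0, 0) 1"
definition R4_c :: R4 where "R4_c = Poly_Mapping.single (0, 0, 1, 0) 1"
definition R4_d :: R4 where "R4_d = Poly_Mapping.single (0, 0, 0, 1) 1"

definition H4_relators :: "(B3 \<Rightarrow>\<^sub>0 R4) set" where
  "H4_relators = range (\<lambda>g. alg_gen g ^ 4 -
     (alg_const R4_a * alg_gen g ^ 3 + alg_const R4_b * alg_gen g ^ 2 + alg_const R4_c * alg_gen g + alg_const R4_d))"

quotient_type H4 = "B3 \<Rightarrow>\<^sub>0 R4" / "ideal_cong H4_relators"
  by (rule ideal_cong_equivp)

text \<open>The class \<open>ring_1\<close> is not used because it includes \<open>0 \<noteq> 1\<close>.\<close>

instantiation H4 :: "{ring, monoid_mult}"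
begin

lift_definition zero_H4 :: H4 is 0 .
lift_definition one_H4 :: H4 is 1 .
lift_definition plus_H4 :: "H4 \<Rightarrow> H4 \<Rightarrow> H4" is "(+)" by (rule ideal_cong_plus)
lift_definition uminus_H4 :: "H4 \<Rightarrow> H4" is uminus by (rule ideal_cong_uminus)
lift_definition minus_H4 :: "H4 \<Rightarrow> H4 \<Rightarrow> H4" is "(-)" by (rule ideal_cong_minus)
lift_definition times_H4 :: "H4 \<Rightarrow> H4 \<Rightarrow> H4" is "(*)" by (rule ideal_cong_times)

instance
  by standard (transfer, simp add: algebra_simps ideal_cong_refl)+

end

definition H4_scale :: "R4 \<Rightarrow> H4 \<Rightarrow> H4" where
  "H4_scale r x = abs_H4 (alg_const r) * x"

global_interpretation H4: module H4_scale
  by standard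
    (simp_all add: H4_scale_def alg_const_simps algebra_simps one_H4.abs_eq[symmetric]
      plus_H4.abs_eq[symmetric] times_H4.abs_eq[symmetric])


section \<open>The generic Hecke algebra of \<open>G\<^sub>8\<close>\<close>

text \<open>The Laurent polynomial ring \<open>\<int>[u\<^sub>1\<^sup>\<plusminus>\<^sup>1, u\<^sub>2\<^sup>\<plusminus>\<^sup>1, u\<^sub>3\<^sup>\<plusminus>\<^sup>1, u\<^sub>4\<^sup>\<plusminus>\<^sup>1]\<close> is the group ring of \<open>\<int>\<^sup>4\<close>.\<close>

type_synonym R4_tilde = "(int \<times> int \<times> int \<times> int) \<Rightarrow>\<^sub>0 int"

definition u1 :: R4_tilde where "u1 = Poly_Mapping.single (1, 0, 0, 0) 1"
definition u2 :: R4_tilde where "u2 = Poly_Mapping.single (0, 1, 0, 0) 1"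
definition u3 :: R4_tilde where "u3 = Poly_Mapping.single (0, 0, 1, 0) 1"
definition u4 :: R4_tilde where "u4 = Poly_Mapping.single (0, 0, 0, 1) 1"

definition hecke_G8_relators :: "(B3 \<Rightarrow>\<^sub>0 R4_tilde) set" where
  "hecke_G8_relators = range (\<lambda>g.
     (alg_gen g - alg_const u1) * (alg_gen g - alg_const u2) * (alg_gen g - alg_const u3) * (alg_gen g - alg_const u4))"

quotient_type hecke_G8 = "B3 \<Rightarrow>\<^sub>0 R4_tilde" / "ideal_cong hecke_G8_relators"
  by (rule ideal_cong_equivp)

instantiation hecke_G8 :: "{ring, monoid_mult}"
begin

lift_definition zero_hecke_G8 :: hecke_G8 is 0 .
lift_definition one_hecke_G8 :: hecke_G8 is 1 .
lift_definition plus_hecke_G8 :: "hecke_G8 \<Rightarrow> hecke_G8 \<Rightarrow> hecke_G8" is "(+)"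
  by (rule ideal_cong_plus)
lift_definition uminus_hecke_G8 :: "hecke_G8 \<Rightarrow> hecke_G8" is uminus
  by (rule ideal_cong_uminus)
lift_definition minus_hecke_G8 :: "hecke_G8 \<Rightarrow> hecke_G8 \<Rightarrow> hecke_G8" is "(-)"
  by (rule ideal_cong_minus)
lift_definition times_hecke_G8 :: "hecke_G8 \<Rightarrow> hecke_G8 \<Rightarrow> hecke_G8" is "(*)"
  by (rule ideal_cong_times)

instance
  by standard (transfer, simp add: algebra_simps ideal_cong_refl)+

end

definition hecke_G8_scale :: "R4_tilde \<Rightarrow> hecke_G8 \<Rightarrow> hecke_G8" where
  "hecke_G8_scale r x = abs_hecke_G8 (alg_const r) * x"

global_interpretation hecke_G8: module hecke_G8_scale
  by standard
    (simp_all add: hecke_G8_scale_def alg_const_simps algebra_simps one_hecke_G8.abs_eq[symmetric]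
      plus_hecke_G8.abs_eq[symmetric] times_hecke_G8.abs_eq[symmetric])

end

(* The algebra is a quotient of the group algebra of B3 = <s, t>; let z = (s t)^3, which is central.

   Spanning: let V be the span of the 96 elements z^k s^m, s^i t z^k s^m, s^i t^2 z s^m
   (i, k, m < 4). It is stable under multiplication by s on both sides. The braid relation gives
   t^-1 z = s^2 t s^2, t^-2 z = s t^2 s and t^-1 s^i t = s t^i s^-1, and with the quartic relations
   these make V stable under left multiplication by t^-1, hence equal to the whole algebra.

   Independence: the structure constants with respect to these elements, found by computer, define
   two 24 x 24 matrices over R[x]/(x^4 - a x^3 - b x^2 - c x - d). They satisfy the defining
   relations, and the 96 elements send the first basis vector to the vectors x^m e_j. The matrix
   identities are polynomial identities in a, b, x and f = x^3 - a x^2 - b x - c, so it is enough to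
   check them over integral domains.

   Both arguments work over every commutative ring in which d is invertible. For a = b = c = 0 and
   d = 1 they also give the order of the group: the spanning argument applies to its group ring, and
   the representation with x a primitive fourth root of unity separates the 96 elements. *)

theory Submission
  imports Defs "HOL-Computational_Algebra.Polynomial" "HOL-Library.Function_Algebras"
begin

section \<open>The matrices of the regular representation\<close>

text \<open>Columns are entered sparsely. Entries with the same index are added, on which the column
  of \<open>t_mat\<close> that appends a list to \<open>z4\<close> relies.\<close>

definition dense :: "(nat \<times> 'a::comm_ring_1) list \<Rightarrow> 'a list" where
  "dense l = map (\<lambda>i. \<Sum>(j, p)\<leftarrow>l. if j = i then p else 0) [0..<24]"

fun lincomb :: "'a::comm_ring_1 list \<Rightarrow> 'a list list \<Rightarrow> 'a list" where
  "lincomb (p # ps) (v # vs) = map2 (+) (map ((*) p) v) (lincomb ps vs)"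
| "lincomb _ _ = replicate 24 0"

text \<open>Matrices are lists of columns: each column of the product combines the columns of
  \<open>A\<close>.\<close>

definition mat_mult :: "'a::comm_ring_1 list list \<Rightarrow> 'a list list \<Rightarrow> 'a list list" where
  "mat_mult A B = map (\<lambda>v. lincomb v A) B"

text \<open>The regular representation. Write \<open>s, t\<close> for the two generators and \<open>z = (s t)\<^sup>3\<close>, which is
  central. As a right module over the subalgebra generated by \<open>s\<close>, whose element \<open>s\<close> acts as
  the scalar \<open>x\<close>, the algebra has the basis \<open>z\<^sup>k\<close> (numbered \<open>k\<close>), \<open>s\<^sup>i t z\<^sup>k\<close> (numbered \<open>4 + 4 k + i\<close>)
  and \<open>s\<^sup>i t\<^sup>2 z\<close> (numbered \<open>20 + i\<close>), where \<open>i, k < 4\<close>. The columns of \<open>s_mat\<close> and \<open>t_mat\<close> are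
  the products of \<open>s\<close> and of \<open>x\<^sup>4 f\<^sup>3 t\<close> with these basis elements, where
  \<open>f = x\<^sup>3 - a x\<^sup>2 - b x - c = d / x\<close>; the factor \<open>x\<^sup>4 f\<^sup>3\<close> clears the denominators.\<close>

definition s_mat :: "'a::comm_ring_1 \<Rightarrow> 'a \<Rightarrow> 'a \<Rightarrow> 'a \<Rightarrow> 'a \<Rightarrow> 'a list list" where
  "s_mat a b c d x = map (\<lambda>j. dense (
     if j < 4 then [(j, x)] else if j mod 4 < 3 then [(j + 1, 1)]
     else [(j - 3, d), (j - 2, c), (j - 1, b), (j, a)])) [0..<24]"

text \<open>\<open>tau\<close> gives \<open>p\<close> times \<open>(X\<^sup>4 - a X\<^sup>3 - b X\<^sup>2 - c X - d) / (X - x)\<close> at \<open>X = s\<close>, applied to the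
  basis element \<open>j\<close>: an eigenvector of \<open>s\<close> with eigenvalue \<open>x\<close>. As \<open>z\<^sup>4\<close> commutes with \<open>s\<close>, its
  coordinates, which \<open>z4\<close> lists, have to be built from such eigenvectors.\<close>

definition tau :: "'a::comm_ring_1 \<Rightarrow> 'a \<Rightarrow> 'a \<Rightarrow> 'a \<Rightarrow> nat \<Rightarrow> 'a \<Rightarrow> (nat \<times> 'a) list" where
  "tau a b x f j p =
    [(j, p * f), (j + 1, p * (x^2 - a * x - b)), (j + 2, p * (x - a)), (j + 3, p)]"

definition z4 :: "'a::comm_ring_1 \<Rightarrow> 'a \<Rightarrow> 'a \<Rightarrow> 'a \<Rightarrow> 'a \<Rightarrow> 'a \<Rightarrow> 'a \<Rightarrow> (nat \<times> 'a) list" where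
  "z4 a b c d x f q =
    [(0, q * (d^5 * x^4)),
     (1, q * (d^2 * x^3 * (c * x * f + 2 * c^2 * x - b^2 * f - a * c^2))),
     (2, q * (x^3 * (c^3 + b * x * f^2 + 2 * b^2 * x^2 * f + a^3 * f^2 - 2 * a * b * c * f
        - a * b^2 * x * f))),
     (3, q * (x * (b^2 * x + a * x * f - 2 * a^2 * f - a^2 * c)))] @
    tau a b x f 4 (q * (c * d^3 * x^5)) @
    tau a b x f 8 (q * (d * x^4 * (c^2 + b * c * x - a * b * f))) @
    tau a b x f 12 (q * (x^3 * (b * c - a^2 * f))) @
    tau a b x f 16 (q * (a * x)) @
    tau a b x f 20 (q * (b * d^2 * x^3))"

definition t_mat :: "'a::comm_ring_1 \<Rightarrow> 'a \<Rightarrow> 'a \<Rightarrow> 'a \<Rightarrow> 'a \<Rightarrow> 'a \<Rightarrow> 'a list list" where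
  "t_mat a b c d x f = map dense
    [[(4, d^3 * x)], [(8, d^3 * x)], [(12, d^3 * x)], [(16, d^3 * x)],
     [(1, -(b * x * f^2)), (5, -(c * d^2 * x^2)), (8, a * c * d), (9, a * b * d), (10, a^2 * d),
      (11, -(a * d)), (20, -(c * d)), (21, -(b * d)), (22, -(a * d)), (23, d)],
     [(5, d^3 * x^2)],
     [(1, x^2 * f^3)],
     [(8, -(c * d^2)), (9, -(b * d^2)), (10, -(a * d^2)), (11, d^2)],
     [(20, d^3 * x)],
     [(9, d^3 * x^2)],
     [(2, x^2 * f^3)],
     [(12, -(c * d^2)), (13, -(b * d^2)), (14, -(a * d^2)), (15, d^2)],
     [(2, b * d^3 * x), (10, c * d^3 * x^3), (12, a * d^3 * x), (21, d^4 * x^2)],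
     [(13, d^3 * x^2)],
     [(3, x^2 * f^3)],
     [(16, -(c * d^2)), (17, -(b * d^2)), (18, -(a * d^2)), (19, d^2)],
     [(2, b * d^4 * x^3), (3, b * d^3 * x), (11, c * d^4 * x^4), (13, a * d^4 * x^2),
      (14, c * d^3 * x^3), (16, a * d^3 * x), (22, d^5 * x^3)],
     [(17, d^3 * x^2)],
     z4 a b c d x f (d^2 * f),
     [(1, c * d^6 * x^3), (2, c * d^4 * x^2 * (c + b * x)), (3, d^3 * x * (b * c - a^2 * f)),
      (7, d^7 * x^4), (9, b * d^6 * x^2), (10, c * d^5 * x^4),
      (11, c * d^4 * x^5 * (x^2 - b - a * x)),
      (13, d^4 * x^2 * (b * x^2 + a * c - b^2 - a * b * x)), (14, d^3 * x^3 * (c^2 - a * b * f)),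
      (15, b * d^4 * x^2), (16, a * d^4), (17, d^3 * x * (b * x - a * b)), (18, -(a^2 * d^3 * x)),
      (19, a * d^3 * x), (21, a * d^6 * x^2), (22, c * d^5 * x^3)] @
     z4 a b c d x f (a * d^2 * f),
     [(1, c * d^3 * x), (6, d^4 * x^3), (8, b * d^3 * x), (20, a * d^3 * x)],
     [(10, d^3 * x^2)],
     [(12, d * x * (c^2 - b * x * f)), (13, d * x * (b * c - a * x * f)),
      (14, d * x * (x * f + a * c)), (15, -(c * d * x))],
     [(2, -(b * c * d^2)), (3, -(a * f^2)), (9, -(c^2 * d^2 * x^3)),
      (12, d * x * (a * c^2 - b * x^2 * f)), (13, a * b * c * d * x), (14, a^2 * c * d * x),
      (15, -(a * c * d * x)), (16, c^2 - b * x * f), (17, b * c - a * x * f), (18, x * f + a * c),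
      (19, - c), (20, -(c * d^3 * x^2))]]"

text \<open>Most coefficients are zero; this rule discards the column without forming products of
  its entries.\<close>

lemma lincomb_0: "lincomb (0 # ps) (v # vs) = map2 (+) (map (\<lambda>_. 0) v) (lincomb ps vs)"
  by (simp cong: map_cong)

lemma upto24: "[0..<24] = [0,1,2,3,4,5,6,7,8,9,10,11,12,13,14,15,16,17,18,19,20,21,22,23::nat]"
  by (simp add: upt_rec)

lemma s_mat_eval: "s_mat a b c d x = map dense
  [[(0, x)], [(1, x)], [(2, x)], [(3, x)],
   [(5, 1)], [(6, 1)], [(7, 1)], [(4, d), (5, c), (6, b), (7, a)],
   [(9, 1)], [(10, 1)], [(11, 1)], [(8, d), (9, c), (10, b), (11, a)],
   [(13, 1)], [(14, 1)], [(15, 1)], [(12, d), (13, c), (14, b), (15, a)],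
   [(17, 1)], [(18, 1)], [(19, 1)], [(16, d), (17, c), (18, b), (19, a)],
   [(21, 1)], [(22, 1)], [(23, 1)], [(20, d), (21, c), (22, b), (23, a)]]"
  by (simp add: s_mat_def upto24)

lemma replicate24: "replicate 24 z = [z,z,z,z,z,z,z,z,z,z,z,z,z,z,z,z,z,z,z,z,z,z,z,z]"
  by (simp add: numeral_eq_Suc)

text \<open>Meant for \<open>simp only\<close>: the matrices are evaluated without distributing
  products, so that polynomial normalisation is left to \<open>algebra\<close>.\<close>

lemmas dense_eval = z4_def tau_def dense_def upto24 list.map append.simps
  sum_list.Cons sum_list.Nil prod.case if_True if_False add_0_left add_0_right
  rel_simps arith_simps numeral_plus_one num.distinct num.inject simp_thms

lemmas lincomb_eval = mat_mult_def lincomb_0 lincomb.simps replicate24 list.map zip_Cons_Cons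
  zip_Nil prod.case mult_zero_left mult_zero_right mult_1_left mult_1_right
  add_0_left add_0_right minus_zero

section \<open>Polynomial identities between the matrices\<close>

definition mat_add :: "'a::comm_ring_1 list list \<Rightarrow> 'a list list \<Rightarrow> 'a list list" where
  "mat_add A B = map2 (map2 (+)) A B"

definition mat_scale :: "'a::comm_ring_1 \<Rightarrow> 'a list list \<Rightarrow> 'a list list" where
  "mat_scale r A = map (map ((*) r)) A"

definition mat_one :: "'a::comm_ring_1 list list" where
  "mat_one = map (\<lambda>j. dense [(j, 1)]) [0..<24]"

lemma mat_one_eval: "mat_one = map dense
  [[(0, 1)], [(1, 1)], [(2, 1)], [(3, 1)], [(4, 1)], [(5, 1)], [(6, 1)], [(7, 1)],
   [(8, 1)], [(9, 1)], [(10, 1)], [(11, 1)], [(12, 1)], [(13, 1)], [(14, 1)], [(15, 1)],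
   [(16, 1)], [(17, 1)], [(18, 1)], [(19, 1)], [(20, 1)], [(21, 1)], [(22, 1)], [(23, 1)]]"
  by (simp add: mat_one_def upto24)

text \<open>The matrix of t carries the factor \<open>x^4 * f^3\<close>; it occurs once on the left
  and twice on the right, hence the scaling. Eliminating \<open>c\<close> and \<open>d\<close> turns
  each of the 576 entries into a polynomial identity in \<open>a\<close>, \<open>b\<close>,
  \<open>x\<close>, \<open>f\<close>.\<close>

lemma braid_idom:
  fixes a b c d x f :: "'a::idom"
  assumes c: "c = x^3 - a * x^2 - b * x - f" and d: "d = x * f"
  defines "S \<equiv> s_mat a b c d x" and "T \<equiv> t_mat a b c d x f"
  shows "mat_scale (x^4 * f^3) (mat_mult S (mat_mult T S)) = mat_mult T (mat_mult S T)"
  unfolding S_def T_def s_mat_eval t_mat_def mat_scale_def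
  apply (simp only: dense_eval)
  apply (simp only: lincomb_eval)
  apply (simp only: list.inject simp_thms)
  apply (simp only: c d power_mult_distrib)
  apply (intro conjI)
   \<comment> \<open>\<open>algebra\<close> fails on equations between single monomials, which the simplifier takes over\<close>
  apply (algebra | (simp add: power_mult_distrib power_numeral_reduce algebra_simps; fail))+
  done

text \<open>Checked for s only; t will inherit the relation, being conjugate to s by the braid
  relation.\<close>

lemma quartic_idom:
  fixes a b c d x f :: "'a::idom"
  assumes c: "c = x^3 - a * x^2 - b * x - f" and d: "d = x * f"
  defines "S \<equiv> s_mat a b c d x"
  shows "mat_mult S (mat_mult S (mat_mult S S)) = mat_add (mat_scale a (mat_mult S (mat_mult S S)))
    (mat_add (mat_scale b (mat_mult S S)) (mat_add (mat_scale c S) (mat_scale d mat_one)))"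
  unfolding S_def s_mat_eval mat_one_eval mat_scale_def mat_add_def
  apply (simp only: dense_eval)
  apply (simp only: lincomb_eval)
  apply (simp only: list.inject simp_thms)
  apply (simp only: c d power_mult_distrib)
  apply (intro conjI)
  apply (algebra | (simp add: power_mult_distrib power_numeral_reduce algebra_simps; fail))+
  done

section \<open>Transfer from integral domains to commutative rings\<close>

definition is_hom :: "('a::comm_ring_1 \<Rightarrow> 'b::comm_ring_1) \<Rightarrow> bool" where
  "is_hom h \<longleftrightarrow> h 1 = 1 \<and> (\<forall>x y. h (x + y) = h x + h y) \<and> (\<forall>x y. h (x * y) = h x * h y)"

lemma is_homD:
  assumes "is_hom h"
  shows "h 1 = 1" "h (x + y) = h x + h y" "h (x * y) = h x * h y" "h 0 = 0" "h (- x) = - h x"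
    "h (x - y) = h x - h y" "h (x ^ n) = h x ^ n" "h 2 = 2"
proof -
  show 1: "h 1 = 1" and a: "h (x + y) = h x + h y" and "h (x * y) = h x * h y" for x y
    using assms by (auto simp: is_hom_def)
  show 0: "h 0 = 0" using a[of 0 0] by simp
  show m: "h (- x) = - h x" for x using a[of x "- x"] 0 by (simp add: eq_neg_iff_add_eq_0 add.commute)
  show "h (x - y) = h x - h y" using a[of x "- y"] m by simp
  show "h (x ^ n) = h x ^ n" using assms by (induction n) (auto simp: is_hom_def)
  show "h 2 = 2" using a[of 1 1] 1 by simp
qed

text \<open>The universal property of the polynomial ring: map the coefficients by \<open>g\<close>
  and evaluate at \<open>x\<close>.\<close>

lemma is_hom_extend_poly:
  fixes g :: "'a::comm_ring_1 \<Rightarrow> 'b::comm_ring_1"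
  assumes g: "is_hom g"
  obtains h :: "'a poly \<Rightarrow> 'b" where "is_hom h" "h [:0, 1:] = x" "\<And>r. h [:r:] = g r"
proof
  define h where "h p = poly (map_poly g p) x" for p
  note g' = is_homD[OF g]
  have pC: "h (pCons r p) = g r + x * h p" for r p
    by (simp add: h_def map_poly_pCons g')
  have h0: "h 0 = 0" by (simp add: h_def)
  have add: "h (p + q) = h p + h q" for p q
    by (induction p q rule: poly_induct2) (simp_all add: h0 pC g' algebra_simps)
  have smult: "h (smult r p) = g r * h p" for r p
    by (induction p) (simp_all add: h0 pC g' algebra_simps)
  have "h (p * q) = h p * h q" for p q
    by (induction p) (simp_all add: h0 pC add smult g' algebra_simps)
  then show "is_hom h"
    using add pC[of 1 0] by (simp add: is_hom_def h0 g' one_pCons)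
  show "h [:0, 1:] = x" "\<And>r. h [:r:] = g r" by (simp_all add: pC h0 g')
qed

lemma hom_dense: "is_hom h \<Longrightarrow> map h (dense l) = dense (map (map_prod id h) l)"
proof -
  assume h: "is_hom h"
  have "h (\<Sum>(j, p)\<leftarrow>l. if j = i then p else 0) = (\<Sum>(j, p)\<leftarrow>map (map_prod id h) l. if j = i then p else 0)" for i
    by (induction l) (auto simp: is_homD[OF h])
  then show ?thesis by (simp add: dense_def)
qed

lemma hom_lincomb: "is_hom h \<Longrightarrow> map h (lincomb ps vs) = lincomb (map h ps) (map (map h) vs)"
proof -
  assume h: "is_hom h"
  have "map h (map2 (+) (map ((*) p) u) v) = map2 (+) (map ((*) (h p)) (map h u)) (map h v)" for p u v
    by (induction u v rule: list_induct2') (auto simp: is_homD[OF h])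
  then show ?thesis
    by (induction ps vs rule: lincomb.induct) (simp_all add: is_homD[OF h])
qed

lemma hom_mat:
  assumes "is_hom h"
  shows "map (map h) (mat_mult A B) = mat_mult (map (map h) A) (map (map h) B)"
    "map (map h) (mat_scale r A) = mat_scale (h r) (map (map h) A)"
    "map (map h) (mat_add A B) = mat_add (map (map h) A) (map (map h) B)"
    "map (map h) mat_one = mat_one"
    "map (map h) (s_mat a b c d x) = s_mat (h a) (h b) (h c) (h d) (h x)"
    "map (map h) (t_mat a b c d x f) = t_mat (h a) (h b) (h c) (h d) (h x) (h f)"
proof -
  note h = is_homD[OF assms]
  show "map (map h) (mat_mult A B) = mat_mult (map (map h) A) (map (map h) B)"
    by (simp add: mat_mult_def hom_lincomb[OF assms])
  show "map (map h) (mat_scale r A) = mat_scale (h r) (map (map h) A)"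
    by (simp add: mat_scale_def h)
  have "map h (map2 (+) u v) = map2 (+) (map h u) (map h v)" for u v
    by (induction u v rule: list_induct2') (auto simp: h)
  then show "map (map h) (mat_add A B) = mat_add (map (map h) A) (map (map h) B)"
    unfolding mat_add_def by (induction A B rule: list_induct2') auto
  show "map (map h) mat_one = mat_one"
    by (simp add: mat_one_def hom_dense[OF assms] h)
  show "map (map h) (s_mat a b c d x) = s_mat (h a) (h b) (h c) (h d) (h x)"
    by (simp add: s_mat_def hom_dense[OF assms] h)
  show "map (map h) (t_mat a b c d x f) = t_mat (h a) (h b) (h c) (h d) (h x) (h f)"
    by (simp add: t_mat_def z4_def tau_def hom_dense[OF assms] h)
qed

text \<open>The tower Z[a][b][x][f] is an integral domain with a homomorphism to \<open>'a\<close>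
  taking its variables to the given elements. It carries the entrywise identities over, since
  \<open>c\<close> and \<open>d\<close> are polynomials in the four variables.\<close>

lemma
  fixes a b c d x f :: "'a::comm_ring_1"
  assumes c: "c = x^3 - a * x^2 - b * x - f" and d: "d = x * f"
  defines "S \<equiv> s_mat a b c d x" and "T \<equiv> t_mat a b c d x f"
  shows mat_braid: "mat_scale (x^4 * f^3) (mat_mult S (mat_mult T S)) = mat_mult T (mat_mult S T)"
    and mat_quartic: "mat_mult S (mat_mult S (mat_mult S S)) =
      mat_add (mat_scale a (mat_mult S (mat_mult S S)))
        (mat_add (mat_scale b (mat_mult S S)) (mat_add (mat_scale c S) (mat_scale d mat_one)))"
proof -
  have "is_hom (of_int :: int \<Rightarrow> 'a)" by (simp add: is_hom_def)
  then obtain h1 :: "int poly \<Rightarrow> 'a" where h1: "is_hom h1" "h1 [:0, 1:] = a"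
    by (metis is_hom_extend_poly)
  obtain h2 :: "int poly poly \<Rightarrow> 'a"
    where h2: "is_hom h2" "h2 [:0, 1:] = b" "\<And>r. h2 [:r:] = h1 r"
    using is_hom_extend_poly[OF h1(1)] by metis
  obtain h3 :: "int poly poly poly \<Rightarrow> 'a"
    where h3: "is_hom h3" "h3 [:0, 1:] = x" "\<And>r. h3 [:r:] = h2 r"
    using is_hom_extend_poly[OF h2(1)] by metis
  obtain h :: "int poly poly poly poly \<Rightarrow> 'a"
    where h: "is_hom h" "h [:0, 1:] = f" "\<And>r. h [:r:] = h3 r"
    using is_hom_extend_poly[OF h3(1)] by metis
  define a' b' x' f' where "a' = [:[:[:[:0, 1 :: int:]:]:]:]" and "b' = [:[:[:0, 1 :: int poly:]:]:]"
    and "x' = [:[:0, 1 :: int poly poly:]:]" and "f' = [:0, 1 :: int poly poly poly:]"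
  have vars: "h a' = a" "h b' = b" "h x' = x" "h f' = f"
    by (simp_all add: a'_def b'_def x'_def f'_def h h1 h2 h3)
  define c' d' where "c' = x'^3 - a' * x'^2 - b' * x' - f'" and "d' = x' * f'"
  have vars': "h c' = c" "h d' = d"
    by (simp_all add: c'_def d'_def c d is_homD[OF h(1)] vars)
  note hom = hom_mat[OF h(1)] vars vars' is_homD[OF h(1)]
  show "mat_scale (x^4 * f^3) (mat_mult S (mat_mult T S)) = mat_mult T (mat_mult S T)"
    using arg_cong[OF braid_idom[OF c'_def d'_def], of "map (map h)"]
    by (simp add: hom S_def T_def)
  show "mat_mult S (mat_mult S (mat_mult S S)) = mat_add (mat_scale a (mat_mult S (mat_mult S S)))
        (mat_add (mat_scale b (mat_mult S S)) (mat_add (mat_scale c S) (mat_scale d mat_one)))"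
    using arg_cong[OF quartic_idom[OF c'_def d'_def], of "map (map h)"]
    by (simp add: hom S_def)
qed

section \<open>Operators on vectors with 24 coordinates\<close>

text \<open>With a type of 24 indices, vectors are total functions with pointwise operations and
  need no length conditions.\<close>

typedef idx = "{..<24::nat}" morphisms nat_of_idx idx_of_nat
  by (rule exI[of _ 0]) simp

lemma sum_idx: "(\<Sum>j\<in>UNIV. g (nat_of_idx j)) = (\<Sum>k<24. g k)"
  using type_definition.Rep_range[OF type_definition_idx]
  by (subst sum.reindex_bij_betw[of nat_of_idx UNIV "{..<24}" g, symmetric])
    (auto simp: bij_betw_def inj_on_def nat_of_idx_inject)

instance idx :: finite
proof
  have "(UNIV :: idx set) = idx_of_nat ` {..<24}"
    using type_definition.Abs_image[OF type_definition_idx] by simp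
  then show "finite (UNIV :: idx set)" by (metis finite_imageI finite_lessThan)
qed

lemma nat_of_idx_less: "nat_of_idx i < 24"
  using nat_of_idx[of i] by simp

type_synonym 'a vec24 = "idx \<Rightarrow> 'a"

definition smul :: "'a::comm_ring_1 \<Rightarrow> 'a vec24 \<Rightarrow> 'a vec24" where
  "smul r v = (\<lambda>i. r * v i)"

definition unit :: "nat \<Rightarrow> 'a::comm_ring_1 vec24" where
  "unit k = (\<lambda>i. if nat_of_idx i = k then 1 else 0)"

definition mat_act :: "'a::comm_ring_1 list list \<Rightarrow> 'a vec24 \<Rightarrow> 'a vec24" where
  "mat_act A v = (\<lambda>i. \<Sum>j\<in>UNIV. v j * A ! nat_of_idx j ! nat_of_idx i)"

interpretation vec24: module smul
  by standard (simp_all add: smul_def fun_eq_iff algebra_simps)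

definition is_mat :: "'a list list \<Rightarrow> bool" where
  "is_mat A \<longleftrightarrow> length A = 24 \<and> (\<forall>v\<in>set A. length v = 24)"

lemma length_lincomb: "(\<And>v. v \<in> set vs \<Longrightarrow> length v = 24) \<Longrightarrow> length (lincomb ps vs) = 24"
  by (induction ps vs rule: lincomb.induct) auto

lemma nth_lincomb:
  assumes "length ps = length vs" "\<And>v. v \<in> set vs \<Longrightarrow> length v = 24" "i < 24"
  shows "lincomb ps vs ! i = (\<Sum>k<length vs. ps ! k * vs ! k ! i)"
  using assms
proof (induction ps vs rule: list_induct2)
  case Nil
  then show ?case by simp
next
  case (Cons p ps v vs)
  then show ?case
    by (simp add: length_lincomb sum.lessThan_Suc_shift del: sum.lessThan_Suc)
qed

lemma is_mat_mult: "is_mat A \<Longrightarrow> is_mat B \<Longrightarrow> is_mat (mat_mult A B)"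
  by (auto simp: is_mat_def mat_mult_def length_lincomb)

lemma is_mat_scale: "is_mat A \<Longrightarrow> is_mat (mat_scale r A)"
  by (auto simp: is_mat_def mat_scale_def)

lemma is_mat_add: "is_mat A \<Longrightarrow> is_mat B \<Longrightarrow> is_mat (mat_add A B)"
  by (auto simp: is_mat_def mat_add_def set_zip)

lemma is_mat_dense: "is_mat (map dense l)" if "length l = 24"
  using that by (auto simp: is_mat_def dense_def)

lemma is_mat_simps: "is_mat mat_one" "is_mat (s_mat a b c d x)" "is_mat (t_mat a b c d x f)"
proof -
  show "is_mat mat_one" by (simp add: mat_one_def is_mat_def dense_def)
  show "is_mat (s_mat a b c d x)" by (simp add: s_mat_def is_mat_def dense_def)
  show "is_mat (t_mat a b c d x f)" unfolding t_mat_def by (rule is_mat_dense) simp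
qed

lemma nth_dense: "i < 24 \<Longrightarrow> dense l ! i = (\<Sum>(j, p)\<leftarrow>l. if j = i then p else 0)"
  by (simp add: dense_def)

lemma mat_act_unit: "k < 24 \<Longrightarrow> mat_act A (unit k) = (\<lambda>i. A ! k ! nat_of_idx i)"
  using sum_idx[of "\<lambda>j. if j = k then A ! k ! _ else 0"]
  by (simp add: mat_act_def unit_def fun_eq_iff if_distrib[of "\<lambda>u. u * _"] cong: if_cong)

lemma mat_act_mult:
  assumes "is_mat A" "is_mat B"
  shows "mat_act (mat_mult A B) v = mat_act A (mat_act B v)"
proof
  fix i
  have "mat_act (mat_mult A B) v i
    = (\<Sum>j\<in>UNIV. v j * (\<Sum>k<24. B ! nat_of_idx j ! k * A ! k ! nat_of_idx i))"
    using assms nat_of_idx_less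
    by (simp add: mat_act_def mat_mult_def is_mat_def nth_lincomb cong: sum.cong)
  also have "\<dots> = (\<Sum>j\<in>UNIV. v j * (\<Sum>k\<in>UNIV. B ! nat_of_idx j ! nat_of_idx k * A ! nat_of_idx k ! nat_of_idx i))"
    by (simp flip: sum_idx)
  also have "\<dots> = mat_act A (mat_act B v) i"
    unfolding mat_act_def sum_distrib_left sum_distrib_right
    by (subst sum.swap) (simp add: mult.assoc)
  finally show "mat_act (mat_mult A B) v i = mat_act A (mat_act B v) i" .
qed

lemma mat_act_scale: "is_mat A \<Longrightarrow> mat_act (mat_scale r A) v = smul r (mat_act A v)"
  using nat_of_idx_less
  by (simp add: mat_act_def mat_scale_def smul_def is_mat_def sum_distrib_left mult.left_commute
      cong: sum.cong)

lemma mat_act_add: "is_mat A \<Longrightarrow> is_mat B \<Longrightarrow> mat_act (mat_add A B) v = mat_act A v + mat_act B v"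
  using nat_of_idx_less
  by (simp add: mat_act_def mat_add_def is_mat_def fun_eq_iff sum.distrib[symmetric] ring_distribs
      cong: sum.cong)

lemma mat_act_one: "mat_act mat_one v = v"
proof
  fix i
  have "mat_act mat_one v i = (\<Sum>j\<in>UNIV. if j = i then v j else 0)"
    unfolding mat_act_def
    by (rule sum.cong) (auto simp: mat_one_def nth_dense nat_of_idx_less nat_of_idx_inject)
  then show "mat_act mat_one v i = v i" by simp
qed

lemma mat_act_linear:
  "mat_act A (v + w) = mat_act A v + mat_act A w"
  "mat_act A (smul r v) = smul r (mat_act A v)"
  by (simp_all add: mat_act_def smul_def fun_eq_iff sum.distrib sum_distrib_left ring_distribs mult.assoc)

lemma vec_sum_units: "v = (\<Sum>k<24. smul (v (idx_of_nat k)) (unit k))"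
proof
  fix i
  have "(\<Sum>k<n. F k) i = (\<Sum>k<n. F k i)" for n and F :: "nat \<Rightarrow> 'a vec24"
    by (induction n) auto
  moreover have "(\<Sum>k<24. smul (v (idx_of_nat k)) (unit k) i) = (\<Sum>k<24. if k = nat_of_idx i then v i else 0)"
    by (rule sum.cong) (auto simp: smul_def unit_def nat_of_idx_inverse)
  moreover have "\<dots> = v i"
    using nat_of_idx_less[of i] by simp
  ultimately show "v i = (\<Sum>k<24. smul (v (idx_of_nat k)) (unit k)) i" by metis
qed

section \<open>The operators of the generators over a ring with a root of the quartic\<close>

locale quartic_root =
  fixes a b c d e x :: "'a::comm_ring_1"
  assumes root: "x^4 = a * x^3 + b * x^2 + c * x + d"
    and unit_d: "d * e = 1"
begin

text \<open>The cofactor d / x of the root. As \<open>d\<close> is a unit, so are \<open>x\<close>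
  and \<open>f\<close>, with inverses \<open>e * f\<close> and \<open>e * x\<close>.\<close>

definition "f = x^3 - a * x^2 - b * x - c"

lemma c_eq: "c = x^3 - a * x^2 - b * x - f"
  by (simp add: f_def)

lemma d_eq: "d = x * f"
  using root by (simp add: f_def algebra_simps power2_eq_square power3_eq_cube power4_eq_xxxx)

definition "S = mat_act (s_mat a b c d x)"

text \<open>The factor removes the denominator cleared in \<open>t_mat\<close>: from d = x f, the
  inverse of x^4 f^3 is e^4 f.\<close>

definition "T v = smul (e^4 * f) (mat_act (t_mat a b c d x f) v)"

lemma S_linear: "S (v + w) = S v + S w" "S (smul r v) = smul r (S v)"
  by (simp_all add: S_def mat_act_linear)

lemma T_linear: "T (v + w) = T v + T w" "T (smul r v) = smul r (T v)"
  by (simp_all add: T_def mat_act_linear vec24.scale_right_distrib mult.commute)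

lemma scaling_unit: "e^4 * f * (x^4 * f^3) = 1"
proof -
  have "e^4 * f * (x^4 * f^3) = (d * e)^4"
    by (simp add: d_eq power_mult_distrib power4_eq_xxxx power3_eq_cube mult_ac)
  then show ?thesis by (simp add: unit_d)
qed

lemma ST_braid: "S (T (S v)) = T (S (T v))"
proof -
  let ?S = "mat_act (s_mat a b c d x)" and ?T = "mat_act (t_mat a b c d x f)"
  let ?w = "e^4 * f" and ?u = "x^4 * f^3"
  have "smul ?u (?S (?T (?S v))) = ?T (?S (?T v))"
    using mat_braid[OF c_eq d_eq, THEN arg_cong, of "\<lambda>A. mat_act A v"]
    by (simp add: mat_act_mult mat_act_scale is_mat_mult is_mat_scale is_mat_simps)
  \<comment> \<open>The right side applies t twice and so takes \<open>?w\<close> twice; on the left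
    one \<open>?w\<close> cancels \<open>?u\<close>.\<close>
  then have "smul ?w (smul ?w (smul ?u (?S (?T (?S v))))) = smul ?w (smul ?w (?T (?S (?T v))))"
    by simp
  moreover have "?w * (?w * ?u) = ?w" using scaling_unit by simp
  ultimately show ?thesis
    by (simp add: S_def T_def mat_act_linear)
qed

lemma S_quartic: "S (S (S (S v))) = smul a (S (S (S v))) + (smul b (S (S v)) + (smul c (S v) + smul d v))"
  using mat_quartic[OF c_eq d_eq, THEN arg_cong, of "\<lambda>A. mat_act A v"]
  by (simp add: S_def mat_act_mult mat_act_scale mat_act_add mat_act_one is_mat_mult is_mat_scale
      is_mat_add is_mat_simps)

text \<open>The inverse as read off from the quartic relation.\<close>

definition "S' v = smul e (S (S (S v)) - (smul a (S (S v)) + (smul b (S v) + smul c v)))"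
definition "T' v = smul e (T (T (T v)) - (smul a (T (T v)) + (smul b (T v) + smul c v)))"

lemma S_diff: "S (v - w) = S v - S w"
  using S_linear(1)[of "v - w" w] by (simp add: eq_diff_eq)

lemma T_diff: "T (v - w) = T v - T w"
  using T_linear(1)[of "v - w" w] by (simp add: eq_diff_eq)

lemma SS': "S (S' v) = v" "S' (S v) = v"
proof -
  have "smul e (smul d v) = v" using unit_d by (simp add: mult.commute)
  then show "S (S' v) = v" "S' (S v) = v"
    by (simp_all add: S'_def S_linear S_diff S_quartic vec24.scale_right_distrib vec24.scale_right_diff_distrib)
qed

lemma S_unit:
  "k < 4 \<Longrightarrow> S (unit k) = smul x (unit k)"
  "4 \<le> k \<Longrightarrow> k < 24 \<Longrightarrow> k mod 4 < 3 \<Longrightarrow> S (unit k) = unit (k + 1)"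
  by (simp_all add: S_def mat_act_unit) (auto simp: s_mat_def nth_dense nat_of_idx_less unit_def smul_def)

lemma xf: "x * (e * f) = 1" "f * (e * x) = 1"
  using unit_d by (simp_all add: d_eq mult_ac)

lemma smul_T: "smul (x^4 * f^3) (T v) = mat_act (t_mat a b c d x f) v"
  using scaling_unit by (simp add: T_def mult.commute)

text \<open>The columns with a single entry that are needed later: t z^k and t (t z) are basis
  elements, and t s^2 t z^k = z^(k+1) s^-2, where s^-1 acts as e f.\<close>

lemma T_unit:
  "k < 4 \<Longrightarrow> T (unit k) = unit (4 * k + 4)"
  "k < 3 \<Longrightarrow> T (unit (4 * k + 6)) = smul ((e * f)\<^sup>2) (unit (k + 1))" (is "_ \<Longrightarrow> ?A k")
  "T (unit 8) = unit 20"
proof -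
  have 3: "e^4 * f * (d^3 * x) = 1"
    using scaling_unit by (simp add: d_eq power_mult_distrib power4_eq_xxxx power3_eq_cube mult_ac)
  have col: "T (unit j) = smul (e^4 * f * p) (unit i)"
    if "j < 24" "t_mat a b c d x f ! j = dense [(i, p)]" for i j p
    using that by (simp add: T_def mat_act_unit) (auto simp: nth_dense nat_of_idx_less unit_def smul_def)
  have k4: "k = 0 \<or> k = 1 \<or> k = 2 \<or> k = 3" if "k < 4" for k :: nat using that by auto
  show "T (unit k) = unit (4 * k + 4)" if "k < 4"
    using col[of k "4 * k + 4" "d^3 * x"] k4[OF that] 3 by (auto simp: t_mat_def)
  have 2: "e^4 * f * (x^2 * f^3) = (e * f)\<^sup>2"
  proof -
    have "e^4 * f * (x^2 * f^3) = (e * f)\<^sup>2 * (x * (e * f))\<^sup>2"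
      by (simp add: power_mult_distrib power4_eq_xxxx power3_eq_cube power2_eq_square mult_ac)
    then show ?thesis by (simp add: xf)
  qed
  show "?A k" if "k < 3"
    using col[of "4 * k + 6" "k + 1" "x^2 * f^3"] k4[of k] that 2 by (auto simp: t_mat_def numeral_2_eq_2 numeral_3_eq_3)
  show "T (unit 8) = unit 20"
    using col[of 8 20 "d^3 * x"] 3 by (simp add: t_mat_def)
qed

text \<open>By the braid relation the range of \<open>T\<close> is stable under \<open>S\<close>, so it contains the basis elements
  that \<open>T\<close> reaches directly and everything that \<open>S\<close> makes of them; the column of \<open>z\<^sup>4\<close> provides
  the last one.\<close>

lemma T_surj: "\<exists>w. T w = v"
proof -
  let ?R = "range T"
  have add: "v + w \<in> ?R" if "v \<in> ?R" "w \<in> ?R" for v w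
    using that by (auto simp flip: T_linear)
  have scale: "smul r w \<in> ?R" if "w \<in> ?R" for r w
    using that by (auto simp flip: T_linear)
  have diff: "v - w \<in> ?R" if "v \<in> ?R" "w \<in> ?R" for v w
    using that by (auto simp flip: T_diff)
  have sum: "(\<Sum>k\<in>K. F k) \<in> ?R" if "\<And>k. k \<in> K \<Longrightarrow> F k \<in> ?R" for K and F :: "nat \<Rightarrow> 'a vec24"
    using that T_linear(2)[of 0 0]
    by (induction K rule: infinite_finite_induct) (auto intro: add rangeI[of T 0])
  have S_stable: "S w \<in> ?R" if w: "w \<in> ?R" for w
  proof -
    obtain u where "w = T u" using w by auto
    \<comment> \<open>Writing u as \<open>S (S' u)\<close> exposes a braid.\<close>
    then have "S w = T (S (T (S' u)))" using ST_braid[of "S' u"] by (simp add: SS')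
    then show ?thesis by simp
  qed
  have block: "unit (m + i) \<in> ?R" if "unit m \<in> ?R" "4 dvd m" "4 \<le> m" "m < 24" "i < 4" for m i
    using \<open>i < 4\<close>
  proof (induction i)
    case (Suc i)
    have "(m + i) mod 4 < 3" "m + i < 24" using that Suc by presburger+
    then show ?case using S_unit(2)[of "m + i"] S_stable[of "unit (m + i)"] Suc that by simp
  qed (use that in simp)
  have start: "unit (4 * k + 4) \<in> ?R" if "k < 4" for k
    using T_unit(1)[OF that] by (metis rangeI)
  have "unit 20 \<in> ?R"
    using T_unit(3) by (metis rangeI)
  then have start': "unit (4 * k + 4) \<in> ?R" if "k < 5" for k
    using start[of k] that by (cases "k = 4") auto
  have high: "unit k \<in> ?R" if "4 \<le> k" "k < 24" for k
  proof -
    have "unit (4 * (k div 4 - 1) + 4 + k mod 4) \<in> ?R"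
      using that by (intro block start') auto
    also have "4 * (k div 4 - 1) + 4 + k mod 4 = k"
      using that by presburger
    finally show ?thesis .
  qed
  have low: "unit k \<in> ?R" if k: "1 \<le> k" "k < 4" for k
  proof -
    obtain j where j: "k = j + 1" "j < 3" using k by (cases k) auto
    have "T (unit (4 * j + 6)) = smul ((e * f)\<^sup>2) (unit k)"
      using T_unit(2)[OF j(2)] j(1) by simp
    then have "smul (x^2) (smul ((e * f)\<^sup>2) (unit k)) \<in> ?R"
      by (metis scale rangeI)
    also have "smul (x^2) (smul ((e * f)\<^sup>2) (unit k)) = unit k"
      using xf(1) by (simp flip: power_mult_distrib)
    finally show ?thesis .
  qed
  have "unit 0 \<in> ?R"
  proof -
    define w where "w = mat_act (t_mat a b c d x f) (unit 18)"
    have w: "w \<in> ?R" unfolding w_def smul_T[symmetric] by (intro scale) simp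
    have "w (idx_of_nat 0) = d^2 * f * (d^5 * x^4)"
      by (simp add: w_def mat_act_unit t_mat_def z4_def tau_def nth_dense idx_of_nat_inverse)
    moreover have "w = smul (w (idx_of_nat 0)) (unit 0) + (\<Sum>k\<in>{1..<24}. smul (w (idx_of_nat k)) (unit k))"
      by (subst vec_sum_units) (simp add: lessThan_atLeast0 sum.atLeast_Suc_lessThan)
    moreover have "(\<Sum>k\<in>{1..<24}. smul (w (idx_of_nat k)) (unit k)) \<in> ?R"
      by (intro sum scale) (use high low in force)
    ultimately have "smul (d^2 * f * (d^5 * x^4)) (unit 0) \<in> ?R"
      using diff[OF w] by (metis add_diff_cancel_right')
    \<comment> \<open>The coefficient is d^7 f x^4; the multiplier is the product of e^7, e x and (e
      f)^4, the inverses of its three factors.\<close>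
    then have "smul (e^7 * (e * x) * (e * f)^4) (smul (d^2 * f * (d^5 * x^4)) (unit 0)) \<in> ?R"
      by (rule scale)
    moreover have "e^7 * (e * x) * (e * f)^4 * (d^2 * f * (d^5 * x^4))
      = (d * e)^7 * (f * (e * x)) * (x * (e * f))^4"
    proof -
      have "d^7 = d^2 * d^5" by (simp flip: power_add)
      then show ?thesis by (simp only: power_mult_distrib mult_ac)
    qed
    ultimately show ?thesis by (simp add: unit_d xf)
  qed
  then have "unit k \<in> ?R" if "k < 24" for k
    using high[of k] low[of k] that by (cases "k = 0"; cases "k < 4") auto
  then have "v \<in> ?R"
    by (subst vec_sum_units) (intro sum scale, simp)
  then show ?thesis by auto
qed

text \<open>By the braid relation, T acts on vectors \<open>S (T w)\<close> as S acts on
  \<open>w\<close>. Surjectivity of T puts every vector into this form.\<close>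

lemma T_quartic: "T (T (T (T v))) = smul a (T (T (T v))) + (smul b (T (T v)) + (smul c (T v) + smul d v))"
proof -
  obtain w where "T w = S' v" using T_surj by blast
  then have v: "v = S (T w)" by (simp add: SS')
  show ?thesis
    unfolding v by (simp flip: ST_braid add: S_quartic S_linear T_linear)
qed

lemma TT': "T (T' v) = v" "T' (T v) = v"
proof -
  have "smul e (smul d v) = v" using unit_d by (simp add: mult.commute)
  then show "T (T' v) = v" "T' (T v) = v"
    by (simp_all add: T'_def T_linear T_diff T_quartic vec24.scale_right_distrib vec24.scale_right_diff_distrib)
qed

end

section \<open>The action of the group algebra\<close>

context quartic_root
begin

fun letter :: "gen \<times> bool \<Rightarrow> 'a vec24 \<Rightarrow> 'a vec24" where
  "letter (S1, True) = S" | "letter (S1, False) = S'"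
| "letter (S2, True) = T" | "letter (S2, False) = T'"

definition word_act :: "word \<Rightarrow> 'a vec24 \<Rightarrow> 'a vec24" where
  "word_act w = foldr letter w"

lemma word_act_cong: "braid_cong v w \<Longrightarrow> word_act v = word_act w"
proof (induction rule: braid_cong.induct)
  case (cancel g e)
  then show ?case
    by (cases g; cases e) (auto simp: word_act_def SS' TT')
\<comment> \<open>Extensionality is restricted to left sides beginning with S, which singles out the
  braid relation.\<close>
qed (auto simp: word_act_def fun_eq_iff[of "S \<circ> _"] ST_braid)

definition act :: "B3 \<Rightarrow> 'a vec24 \<Rightarrow> 'a vec24" where
  "act g = word_act (rep_B3 g)"

lemma act_abs: "act (abs_B3 w) = word_act w"
  unfolding act_def using word_act_cong by (metis B3.abs_eq_iff Quotient_B3 Quotient_abs_rep)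

lemma act_plus: "act (g + h) v = act g (act h v)"
proof -
  obtain u w where "g = abs_B3 u" "h = abs_B3 w"
    by (metis Quotient_B3 Quotient_abs_rep)
  then show ?thesis
    by (simp add: plus_B3.abs_eq act_abs) (simp add: word_act_def)
qed

lemma act_0: "act 0 v = v"
  by (simp add: zero_B3_def act_abs) (simp add: word_act_def)

lemma act_gen: "act (braid_gen S1) = S" "act (braid_gen S2) = T"
  by (simp_all add: braid_gen.abs_eq act_abs) (simp_all add: word_act_def)

lemma S'_linear: "S' (v + w) = S' v + S' w" "S' (smul r v) = smul r (S' v)"
  by (simp_all add: S'_def S_linear vec24.scale_right_distrib vec24.scale_right_diff_distrib
      mult_ac)

lemma T'_linear: "T' (v + w) = T' v + T' w" "T' (smul r v) = smul r (T' v)"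
  by (simp_all add: T'_def T_linear vec24.scale_right_distrib vec24.scale_right_diff_distrib
      mult_ac)

lemma act_linear: "act g (v + w) = act g v + act g w" "act g (smul r v) = smul r (act g v)"
proof -
  have "letter l (v + w) = letter l v + letter l w" "letter l (smul r v) = smul r (letter l v)"
    for l v w r
    by (cases l rule: letter.cases; simp add: S_linear T_linear S'_linear T'_linear)+
  then have "word_act u (v + w) = word_act u v + word_act u w"
    "word_act u (smul r v) = smul r (word_act u v)" for u
    unfolding word_act_def by (induction u) simp_all
  then show "act g (v + w) = act g v + act g w" "act g (smul r v) = smul r (act g v)"
    by (simp_all add: act_def)
qed

end

section \<open>Linear extension to the group algebra\<close>

lemma poly_mapping_single_add_induct [case_names zero single add]:
  assumes "P 0" "\<And>k r. P (Poly_Mapping.single k r)" "\<And>p q. P p \<Longrightarrow> P q \<Longrightarrow> P (p + q)"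
  shows "P (p :: 'k \<Rightarrow>\<^sub>0 'r::comm_monoid_add)"
proof (induction p rule: update_induct)
  case const
  then show ?case by (rule assms(1))
next
  case (update f k r)
  then have "Poly_Mapping.update k r f = Poly_Mapping.single k r + f"
    by (intro poly_mapping_eqI) (auto simp: lookup_update lookup_add lookup_single in_keys_iff when_def)
  then show ?case using assms(2,3) update by simp
qed

definition quartic_relator :: "'r::comm_ring_1 \<Rightarrow> 'r \<Rightarrow> 'r \<Rightarrow> 'r \<Rightarrow> gen \<Rightarrow> B3 \<Rightarrow>\<^sub>0 'r" where
  "quartic_relator a b c d g = alg_gen g ^ 4 -
     (alg_const a * alg_gen g ^ 3 + alg_const b * alg_gen g ^ 2 + alg_const c * alg_gen g + alg_const d)"

text \<open>Coefficients come from \<open>'r\<close>, while the matrices need a ring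
  \<open>'a\<close> containing a root of the quartic; \<iota> connects the two.\<close>

locale quartic_rep = quartic_root "\<iota> a" "\<iota> b" "\<iota> c" "\<iota> d" "\<iota> e" x
  for \<iota> :: "'r::comm_ring_1 \<Rightarrow> 'a::comm_ring_1" and a b c d e x +
  assumes hom: "is_hom \<iota>"
begin

definition alg_act :: "(B3 \<Rightarrow>\<^sub>0 'r) \<Rightarrow> 'a vec24 \<Rightarrow> 'a vec24" where
  "alg_act p v = (\<Sum>g\<in>Poly_Mapping.keys p. smul (\<iota> (Poly_Mapping.lookup p g)) (act g v))"

text \<open>Additivity needs one index set for the supports of both summands and of their
  sum.\<close>

lemma alg_act_superset:
  assumes "finite K" "Poly_Mapping.keys p \<subseteq> K"
  shows "alg_act p v = (\<Sum>g\<in>K. smul (\<iota> (Poly_Mapping.lookup p g)) (act g v))"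
  unfolding alg_act_def using assms
  by (intro sum.mono_neutral_left) (auto simp: in_keys_iff is_homD[OF hom])

lemma alg_act_add: "alg_act (p + q) v = alg_act p v + alg_act q v"
proof -
  let ?K = "Poly_Mapping.keys p \<union> Poly_Mapping.keys q"
  have "finite ?K" "Poly_Mapping.keys (p + q) \<subseteq> ?K" "Poly_Mapping.keys p \<subseteq> ?K" "Poly_Mapping.keys q \<subseteq> ?K"
    using Poly_Mapping.keys_add[of p q] by auto
  then show ?thesis
    by (simp add: alg_act_superset[of ?K] lookup_add is_homD[OF hom] vec24.scale_left_distrib
        sum.distrib)
qed

lemma alg_act_single: "alg_act (Poly_Mapping.single g r) v = smul (\<iota> r) (act g v)"
  by (cases "r = 0") (simp_all add: alg_act_def is_homD[OF hom])

lemma alg_act_zero: "alg_act 0 v = 0"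
  by (simp add: alg_act_def)

lemma alg_act_linear: "alg_act p (v + w) = alg_act p v + alg_act p w"
  "alg_act p (smul r v) = smul r (alg_act p v)" "alg_act p 0 = 0"
proof -
  show "alg_act p (v + w) = alg_act p v + alg_act p w" "alg_act p (smul r v) = smul r (alg_act p v)"
    for p v w r
    by (simp_all add: alg_act_def act_linear vec24.scale_right_distrib vec24.scale_sum_right
        sum.distrib mult.commute)
  from this(2)[of p 0 0] show "alg_act p 0 = 0" by simp
qed

lemma alg_act_mult: "alg_act (p * q) v = alg_act p (alg_act q v)"
proof (induction p rule: poly_mapping_single_add_induct)
  case (single g r)
  show ?case
  proof (induction q rule: poly_mapping_single_add_induct)
    case zero
    show ?case by (simp only: mult_zero_right alg_act_zero alg_act_linear)
  next
    case (single h r')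
    show ?case
      by (simp add: mult_single alg_act_single act_plus act_linear is_homD[OF hom] mult.commute)
  next
    case (add p q)
    then show ?case by (simp only: distrib_left alg_act_add alg_act_linear)
  qed
qed (simp_all add: alg_act_zero alg_act_add ring_distribs)

lemma alg_act_ideal:
  assumes "p \<in> ideal_gen X" "\<And>q v. q \<in> X \<Longrightarrow> alg_act q v = 0"
  shows "alg_act p v = 0"
  using assms
  by (induction arbitrary: v rule: ideal_gen.induct)
    (simp_all add: alg_act_zero alg_act_add alg_act_mult alg_act_linear)

lemma alg_act_const: "alg_act (alg_const r) v = smul (\<iota> r) v"
  by (simp add: alg_const_def alg_act_single act_0)

lemma alg_act_diff: "alg_act (p - q) v = alg_act p v - alg_act q v"
  using alg_act_add[of "p - q" q v] by (simp add: eq_diff_eq)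

lemma alg_act_relator: "alg_act (quartic_relator a b c d g) v = 0"
proof -
  have "alg_act (alg_gen S1) v = S v" "alg_act (alg_gen S2) v = T v" for v
    by (simp_all add: alg_gen_def alg_act_single act_gen is_homD[OF hom])
  then show ?thesis
    by (cases g) (simp_all add: quartic_relator_def alg_act_diff alg_act_add alg_act_mult alg_act_const
        power4_eq_xxxx power3_eq_cube power2_eq_square mult.assoc S_quartic T_quartic add.assoc)
qed

end

section \<open>The 96 elements and their action on the first basis vector\<close>

definition nmult :: "nat \<Rightarrow> 'g::monoid_add \<Rightarrow> 'g" where
  "nmult n g = ((+) g ^^ n) 0"

text \<open>The central element (s t)^3, rewritten by a braid move as (s t s)^2, whose letters act
  on the vectors z^k through single-entry columns.\<close>

definition full_twist :: B3 where
  "full_twist = (let s = braid_gen S1; t = braid_gen S2 in s + t + s + s + t + s)"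

text \<open>The index \<open>j\<close> numbers the basis vectors, so \<open>j div 4 - 1\<close>
  recovers k from j = 4 + 4 k + i. The final power of s supplies the scalar
  \<open>x ^ m\<close>.\<close>

definition basis_elt :: "nat \<Rightarrow> nat \<Rightarrow> B3" where
  "basis_elt j m = (let s = braid_gen S1; t = braid_gen S2; z = full_twist in
     (if j < 4 then nmult j z else if j < 20 then nmult (j mod 4) s + t + nmult (j div 4 - 1) z
      else nmult (j mod 4) s + t + t + z) + nmult m s)"

context quartic_root
begin

lemma act_nmult: "act (nmult n g) v = (act g ^^ n) v"
  by (induction n) (simp_all add: nmult_def act_0 act_plus)

lemma funpow_S_unit:
  assumes "4 \<le> k" "k < 24" "k mod 4 = 0" "i < 4"
  shows "(S ^^ i) (unit k) = unit (k + i)"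
  using assms(4)
proof (induction i)
  case (Suc i)
  have "(k + i) mod 4 < 3" "k + i < 24" using assms Suc.prems by presburger+
  then show ?case using Suc assms by (simp add: S_unit)
qed simp

text \<open>The outer letters s each contribute x and the inner t s^2 t contributes x^-2. The bound
  is due to z^4 not being a basis vector.\<close>

lemma act_full_twist: "k < 3 \<Longrightarrow> act full_twist (unit k) = unit (k + 1)"
proof -
  assume k: "k < 3"
  have "(S ^^ 2) (unit (4 * k + 4)) = unit (4 * k + 4 + 2)"
    using k by (intro funpow_S_unit) auto
  also have "4 * k + 4 + 2 = 4 * k + 6" by simp
  finally have "(S ^^ 2) (unit (4 * k + 4)) = unit (4 * k + 6)" .
  then have "S (S (T (S (unit k)))) = smul x (unit (4 * k + 6))"
    using k by (simp add: S_unit T_unit S_linear T_linear numeral_2_eq_2)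
  then have "S (T (S (S (T (S (unit k)))))) = smul (x * (e * f)\<^sup>2 * x) (unit (k + 1))"
    using k by (simp add: S_unit T_unit S_linear T_linear)
  also have "x * (e * f)\<^sup>2 * x = (x * (e * f))\<^sup>2"
    by (simp add: power2_eq_square mult_ac)
  finally show ?thesis by (simp add: xf full_twist_def Let_def act_plus act_gen)
qed

lemma act_basis_elt:
  assumes "j < 24"
  shows "act (basis_elt j m) (unit 0) = smul (x ^ m) (unit j)"
proof -
  have s: "act (nmult m (braid_gen S1)) (unit 0) = smul (x ^ m) (unit 0)" for m
    by (induction m) (simp_all add: act_nmult act_gen S_linear S_unit mult.commute)
  have z: "act (nmult k full_twist) (unit 0) = unit k" if "k < 4" for k
    using that by (induction k) (simp_all add: act_nmult act_full_twist)
  consider "j < 4" | "4 \<le> j" "j < 20" | "20 \<le> j" by linarith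
  then have "act (basis_elt j 0) (unit 0) = unit j"
  proof cases
    case 1
    then show ?thesis using z[of j] by (simp add: basis_elt_def Let_def nmult_def)
  next
    case 2
    then have k: "j div 4 - 1 < 4" "4 * (j div 4 - 1) + 4 + j mod 4 = j" by presburger+
    then show ?thesis
      using 2 z[OF k(1)] T_unit(1)[OF k(1)] funpow_S_unit[of "4 * (j div 4 - 1) + 4" "j mod 4"]
      by (simp add: basis_elt_def Let_def act_plus act_nmult act_gen act_0)
  next
    case 3
    have "20 + j mod 4 = j" using assms 3 by presburger
    then show ?thesis
      using 3 act_full_twist[of 0] T_unit(1)[of 1] T_unit(3) funpow_S_unit[of 20 "j mod 4"]
      by (simp add: basis_elt_def Let_def act_plus act_nmult act_gen act_0)
  qed
  moreover have "basis_elt j m = basis_elt j 0 + nmult m (braid_gen S1)"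
    by (simp add: basis_elt_def Let_def nmult_def)
  ultimately show ?thesis by (simp add: act_plus s act_linear)
qed

end

text \<open>Applied to the first basis vector, the combination has this cubic expression in
  \<open>x\<close> as its coordinate \<open>j\<close>.\<close>

lemma (in quartic_rep) basis_coeffs:
  assumes "alg_act (\<Sum>j<24. \<Sum>m<4. Poly_Mapping.single (basis_elt j m) (r j m)) (unit 0) = 0" "j < 24"
  shows "(\<Sum>m<4. \<iota> (r j m) * x ^ m) = 0"
proof -
  have sum: "alg_act (\<Sum>i<n. F i) v = (\<Sum>i<n. alg_act (F i) v)" for F v and n :: nat
    by (induction n) (simp_all add: alg_act_zero alg_act_add)
  have sum': "(\<Sum>i<n. F i) k = (\<Sum>i<n. F i k)" for n and F :: "nat \<Rightarrow> 'a vec24" and k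
    by (induction n) auto
  have "(\<Sum>i<24. \<Sum>m<4. smul (\<iota> (r i m) * x ^ m) (unit i)) = (\<Sum>i<24. \<Sum>m<4. smul (\<iota> (r i m)) (act (basis_elt i m) (unit 0)))"
    by (intro sum.cong) (auto simp: act_basis_elt)
  also have "\<dots> = 0"
    using assms(1) by (simp add: sum alg_act_single)
  finally have "0 = (\<Sum>i<24. \<Sum>m<4. smul (\<iota> (r i m) * x ^ m) (unit i)) (idx_of_nat j)"
    by simp
  also have "\<dots> = (\<Sum>i<24. if i = j then (\<Sum>m<4. \<iota> (r i m) * x ^ m) else 0)"
    unfolding sum' using assms(2)
    by (intro sum.cong) (auto simp: smul_def unit_def idx_of_nat_inverse)
  also have "\<dots> = (\<Sum>m<4. \<iota> (r j m) * x ^ m)" using assms(2) by simp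
  finally show ?thesis by simp
qed

section \<open>The 96 elements span\<close>

text \<open>One setting for the two Hecke algebras and for the integral group ring of
  \<open>G8\<close>.\<close>

locale B3_algebra = module scale
  for scale :: "'r::comm_ring_1 \<Rightarrow> 'h::{ring, monoid_mult} \<Rightarrow> 'h" (infixr "\<bullet>" 75) +
  fixes \<pi> :: "B3 \<Rightarrow> 'h" and a b c d e :: 'r
  assumes scale_mult: "(r \<bullet> x) * y = r \<bullet> (x * y)" "x * (r \<bullet> y) = r \<bullet> (x * y)"
    and \<pi>_0: "\<pi> 0 = 1"
    and \<pi>_plus: "\<pi> (g + h) = \<pi> g * \<pi> h"
    and de: "d * e = 1"
    and quartic: "\<pi> (braid_gen k) ^ 4 =
      a \<bullet> \<pi> (braid_gen k) ^ 3 + b \<bullet> \<pi> (braid_gen k) ^ 2 + c \<bullet> \<pi> (braid_gen k) + d \<bullet> 1"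
    and span_range: "span (range \<pi>) = UNIV"
begin

section \<open>Relations between s, t and the central element\<close>

definition "s = \<pi> (braid_gen S1)"
definition "t = \<pi> (braid_gen S2)"
definition "s' = \<pi> (- braid_gen S1)"
definition "t' = \<pi> (- braid_gen S2)"
definition "z = s * (t * (s * (s * (t * s))))"

lemma inverses: "s * s' = 1" "s' * s = 1" "t * t' = 1" "t' * t = 1"
  by (simp_all add: s_def s'_def t_def t'_def \<pi>_0 flip: \<pi>_plus)

lemma inverses_left: "s * (s' * w) = w" "s' * (s * w) = w" "t * (t' * w) = w" "t' * (t * w) = w"
  by (simp_all add: inverses flip: mult.assoc)

lemma braid: "s * (t * s) = t * (s * t)"
proof -
  have "braid_gen S1 + (braid_gen S2 + braid_gen S1) = braid_gen S2 + (braid_gen S1 + braid_gen S2)"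
    by transfer (use braid_cong.braid in simp)
  then show ?thesis by (simp add: s_def t_def flip: \<pi>_plus)
qed

lemma braid_left: "s * (t * (s * w)) = t * (s * (t * w))"
  using braid by (metis mult.assoc)

text \<open>Forms beginning with t and with t^2, from which t^-1 z and t^-2 z become positive words
  by cancellation.\<close>

lemma z_alt: "z = t * (s * (s * (t * (s * s))))" "z = t * (t * (s * (t * (t * s))))"
proof -
  show 1: "z = t * (s * (s * (t * (s * s))))"
    unfolding z_def by (metis braid braid_left)
  show "z = t * (t * (s * (t * (t * s))))"
    unfolding 1 by (metis braid braid_left)
qed

lemma z_commute: "z * s = s * z" "z * t = t * z"
proof -
  show "z * s = s * z"
    unfolding z_def mult.assoc by (metis braid braid_left)
  show "z * t = t * z"
    unfolding z_def mult.assoc by (metis braid braid_left)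
qed

lemma commute_inverse:
  assumes "z * y = y * z" "y * y' = 1" "y' * y = 1"
  shows "z * y' = y' * z"
proof -
  have "y' * (z * y) * y' = y' * (y * z) * y'" by (simp add: assms)
  then show ?thesis
    by (metis assms(2,3) mult.assoc mult_1_left mult_1_right)
qed

lemma z_commute': "z * s' = s' * z" "z * t' = t' * z"
  using commute_inverse z_commute inverses by blast+

lemma z_left: "z * (s * w) = s * (z * w)" "z * (t * w) = t * (z * w)"
  "z * (s' * w) = s' * (z * w)" "z * (t' * w) = t' * (z * w)"
  by (metis z_commute z_commute' mult.assoc)+

lemma t'_z: "t' * z = s * (s * (t * (s * s)))" "t' * (t' * z) = s * (t * (t * s))"
  by (simp only: z_alt(1) inverses_left) (simp only: z_alt(2) inverses_left)

lemma braid_inverses: "t * (s * t') = s' * (t * s)" "t' * (s * t) = s * (t * s')" "s' * t = t * (s * (t' * s'))"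
  "t' * (s' * t) = s * (t' * s')" "t' * (s' * t') = s' * (t' * s')"
proof -
  show 1: "t * (s * t') = s' * (t * s)"
    by (metis braid inverses_left mult.assoc inverses(3) mult_1_right)
  show 2: "t' * (s * t) = s * (t * s')"
    by (metis braid inverses_left mult.assoc inverses(1) mult_1_right)
  show 3: "s' * t = t * (s * (t' * s'))"
    by (metis 1 inverses(1) mult.assoc mult_1_right)
  show 4: "t' * (s' * t) = s * (t' * s')"
    using 3 by (simp add: inverses_left)
  show "t' * (s' * t') = s' * (t' * s')"
    by (metis 4 inverses_left(2) inverses(3) mult.assoc mult_1_right)
qed

lemma quartics:
  "s * (s * (s * s)) = a \<bullet> (s * (s * s)) + b \<bullet> (s * s) + c \<bullet> s + d \<bullet> 1"
  "t * (t * (t * t)) = a \<bullet> (t * (t * t)) + b \<bullet> (t * t) + c \<bullet> t + d \<bullet> 1"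
  using quartic[of S1] quartic[of S2]
  by (simp_all add: s_def t_def power4_eq_xxxx power3_eq_cube power2_eq_square mult.assoc)

lemma e_d: "(e * d) \<bullet> x = x"
  using de by (simp add: mult.commute)

text \<open>The quartic relation divided repeatedly by y, so that positive powers can be traded for
  negative ones and back.\<close>

lemma quartic_shift:
  assumes q: "y * (y * (y * y)) = a \<bullet> (y * (y * y)) + b \<bullet> (y * y) + c \<bullet> y + d \<bullet> 1"
    and y: "y * y' = 1" "y' * y = 1"
  shows "y * (y * y) = a \<bullet> (y * y) + b \<bullet> y + c \<bullet> 1 + d \<bullet> y'"
    "y * y = a \<bullet> y + b \<bullet> 1 + c \<bullet> y' + d \<bullet> (y' * y')"
    "y = a \<bullet> 1 + b \<bullet> y' + c \<bullet> (y' * y') + d \<bullet> (y' * (y' * y'))"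
    "y' = e \<bullet> (y * (y * y) - a \<bullet> (y * y) - b \<bullet> y - c \<bullet> 1)"
proof -
  have l: "y' * (y * w) = w" for w using y by (metis mult.assoc mult_1_left)
  show 3: "y * (y * y) = a \<bullet> (y * y) + b \<bullet> y + c \<bullet> 1 + d \<bullet> y'"
    using arg_cong[OF q, of "\<lambda>w. y' * w"] by (simp add: ring_distribs scale_mult l y)
  show 2: "y * y = a \<bullet> y + b \<bullet> 1 + c \<bullet> y' + d \<bullet> (y' * y')"
    using arg_cong[OF 3, of "\<lambda>w. y' * w"] by (simp add: ring_distribs scale_mult l y)
  show "y = a \<bullet> 1 + b \<bullet> y' + c \<bullet> (y' * y') + d \<bullet> (y' * (y' * y'))"
    using arg_cong[OF 2, of "\<lambda>w. y' * w"] by (simp add: ring_distribs scale_mult l y)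
  show "y' = e \<bullet> (y * (y * y) - a \<bullet> (y * y) - b \<bullet> y - c \<bullet> 1)"
    unfolding 3 by (simp add: e_d)
qed

lemmas s_shift = quartic_shift[OF quartics(1) inverses(1,2)]
lemmas t_shift = quartic_shift[OF quartics(2) inverses(3,4)]

text \<open>Replacing the last s t by t (t^-1 s t) = t s t s^-1 and inserting s s^-1 exposes the
  form t s s t s s of z.\<close>

lemma t_sss_t: "t * (s * (s * (s * t))) = z * (s' * (t * s'))"
proof -
  have "t * (s * (s * (s * t))) = t * (s * (s * (t * (t' * (s * t)))))"
    by (simp add: inverses_left)
  also have "\<dots> = t * (s * (s * (t * (s * (s * (s' * (t * s')))))))"
    by (simp add: braid_inverses inverses_left)
  also have "\<dots> = z * (s' * (t * s'))"
    by (simp add: z_alt(1) mult.assoc)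
  finally show ?thesis .
qed

text \<open>The quartic relation turns s^-1 into positive powers, leaving words t s^i t with i at
  most 3, each of which simplifies by the braid relation.\<close>

lemma t_s'_t_expand: "t * (s' * t) = e \<bullet> (z * (s' * (t * s')) - a \<bullet> (z * (s' * s')) - b \<bullet> (s * (t * s)) - c \<bullet> (t * t))"
proof -
  have "t * (s * (s * t)) = z * (s' * s')"
    by (simp add: z_alt(1) mult.assoc inverses_left inverses)
  then show ?thesis
    by (subst s_shift(4)) (simp add: ring_distribs scale_mult mult.assoc t_sss_t braid)
qed

section \<open>Stability of the span under the generators\<close>

definition "V = span {\<pi> (basis_elt j m) | j m. j < 24 \<and> m < 4}"

lemma V_closed: "0 \<in> V" "v \<in> V \<Longrightarrow> w \<in> V \<Longrightarrow> v + w \<in> V" "v \<in> V \<Longrightarrow> w \<in> V \<Longrightarrow> v - w \<in> V"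
  "v \<in> V \<Longrightarrow> r \<bullet> v \<in> V"
  by (simp_all add: V_def span_zero span_add span_diff span_scale)

lemma V_induct:
  assumes "v \<in> V" "\<And>j m. j < 24 \<Longrightarrow> m < 4 \<Longrightarrow> f (\<pi> (basis_elt j m)) \<in> V"
    "f 0 = 0" "\<And>v w. f (v + w) = f v + f w" "\<And>r v. f (r \<bullet> v) = r \<bullet> f v"
  shows "f v \<in> V"
  using assms(1) unfolding V_def
proof (induction rule: span_induct_alt)
  case base
  show ?case by (simp add: assms span_zero)
next
  case (step r v w)
  then have "f v \<in> V" using assms(2) by auto
  then show ?case using step by (simp add: assms V_def span_add span_scale)
qed

lemma \<pi>_nmult: "\<pi> (nmult n g) = \<pi> g ^ n"
  by (induction n) (simp_all add: nmult_def \<pi>_0 \<pi>_plus)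

lemma \<pi>_full_twist: "\<pi> full_twist = z"
  by (simp add: full_twist_def Let_def \<pi>_plus z_def s_def t_def mult.assoc)

lemma \<pi>_basis_elt: "\<pi> (basis_elt j m) =
  (if j < 4 then z ^ j else if j < 20 then s ^ (j mod 4) * (t * z ^ (j div 4 - 1))
   else s ^ (j mod 4) * (t * (t * z))) * s ^ m"
  by (simp add: basis_elt_def Let_def \<pi>_plus \<pi>_nmult \<pi>_full_twist mult.assoc flip: s_def t_def)

lemma \<pi>_basis_elt_0: "\<pi> (basis_elt j m) = \<pi> (basis_elt j 0) * s ^ m"
  by (simp add: \<pi>_basis_elt)

lemma basis_in_V: "j < 24 \<Longrightarrow> m < 4 \<Longrightarrow> \<pi> (basis_elt j m) \<in> V"
  unfolding V_def by (rule span_base) auto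

lemma V_basic: "k < 4 \<Longrightarrow> z ^ k \<in> V" "i < 4 \<Longrightarrow> k < 4 \<Longrightarrow> s ^ i * (t * z ^ k) \<in> V"
  "i < 4 \<Longrightarrow> s ^ i * (t * (t * z)) \<in> V"
proof -
  show "k < 4 \<Longrightarrow> z ^ k \<in> V"
    using basis_in_V[of k 0] by (simp add: \<pi>_basis_elt)
  show "s ^ i * (t * (t * z)) \<in> V" if "i < 4"
  proof -
    have "(20 + i) mod 4 = i" using that by presburger
    then show ?thesis using basis_in_V[of "20 + i" 0] that by (simp add: \<pi>_basis_elt)
  qed
  show "s ^ i * (t * z ^ k) \<in> V" if "i < 4" "k < 4"
  proof -
    have "4 * k + 4 + i < 20" "(4 * k + 4 + i) mod 4 = i" "(4 * k + 4 + i) div 4 - 1 = k"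
      using that by presburger+
    then show ?thesis using basis_in_V[of "4 * k + 4 + i" 0] by (simp add: \<pi>_basis_elt del: mod_add_left_eq)
  qed
qed

lemma V_right_s: "v * s \<in> V" if "v \<in> V"
  using that
proof (rule V_induct[where f = "\<lambda>v. v * s"])
  fix j m :: nat assume j: "j < 24" and m: "m < 4"
  show "\<pi> (basis_elt j m) * s \<in> V"
  proof (cases "m = 3")
    case True
    define y where "y = \<pi> (basis_elt j 0)"
    have "\<pi> (basis_elt j m) * s = y * (s * (s * (s * s)))"
      using \<pi>_basis_elt_0[of j 3] True by (simp add: y_def power3_eq_cube mult.assoc)
    also have "\<dots> = a \<bullet> (y * s ^ 3) + b \<bullet> (y * s ^ 2) + c \<bullet> (y * s ^ 1) + d \<bullet> (y * s ^ 0)"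
      by (simp add: quartics ring_distribs scale_mult power3_eq_cube power2_eq_square mult.assoc)
    also have "\<dots> \<in> V"
    proof -
      have "y * s ^ k \<in> V" if "k < 4" for k
        unfolding y_def \<pi>_basis_elt_0[symmetric] using j that by (rule basis_in_V)
      from this[of 3] this[of 2] this[of 1] this[of 0] show ?thesis
        by (intro V_closed) simp_all
    qed
    finally show ?thesis .
  next
    case False
    have "\<pi> (basis_elt j m) * s = \<pi> (basis_elt j (m + 1))"
      using \<pi>_basis_elt_0[of j m] \<pi>_basis_elt_0[of j "m + 1"]
      by (simp add: power_commutes mult.assoc)
    then show ?thesis using basis_in_V[of j "m + 1"] j m False by simp
  qed
qed (simp_all add: ring_distribs scale_mult)

lemma V_right_s': "v * s' \<in> V" if "v \<in> V"
proof -
  have "v * s' = e \<bullet> (v * s * s * s - a \<bullet> (v * s * s) - b \<bullet> (v * s) - c \<bullet> v)"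
    by (subst s_shift(4)) (simp add: ring_distribs scale_mult mult.assoc)
  then show ?thesis using that by (simp add: V_closed V_right_s)
qed

text \<open>Left multiplication commutes with the right factor s^m, and V is closed under right
  multiplication by s, so m = 0 suffices.\<close>

lemma V_left_induct:
  assumes "v \<in> V" "\<And>k. k < 4 \<Longrightarrow> y * z ^ k \<in> V" "\<And>i k. i < 4 \<Longrightarrow> k < 4 \<Longrightarrow> y * (s ^ i * (t * z ^ k)) \<in> V"
    "\<And>i. i < 4 \<Longrightarrow> y * (s ^ i * (t * (t * z))) \<in> V"
  shows "y * v \<in> V"
  using assms(1)
proof (rule V_induct[where f = "\<lambda>v. y * v"])
  fix j m :: nat assume j: "j < 24" and m: "m < 4"
  have right: "v * s ^ m \<in> V" if "v \<in> V" for v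
    using that by (induction m arbitrary: v) (simp_all add: V_right_s power_commutes flip: mult.assoc)
  have "j div 4 - 1 < 4" if "j < 20" using that by presburger
  then have "y * \<pi> (basis_elt j 0) \<in> V"
    using assms j by (simp add: \<pi>_basis_elt)
  then show "y * \<pi> (basis_elt j m) \<in> V"
    by (simp add: \<pi>_basis_elt_0[of j m] right flip: mult.assoc)
qed (simp_all add: ring_distribs scale_mult)

lemma z_power_commute: "z ^ k * s = s * z ^ k" "z ^ k * t = t * z ^ k" "z ^ k * s' = s' * z ^ k" "z ^ k * t' = t' * z ^ k"
  using z_commute z_commute' by (simp_all add: power_commuting_commutes)

lemma z_power_left: "z ^ k * (s * w) = s * (z ^ k * w)" "z ^ k * (t * w) = t * (z ^ k * w)"
  "z ^ k * (s' * w) = s' * (z ^ k * w)" "z ^ k * (t' * w) = t' * (z ^ k * w)"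
  by (metis z_power_commute mult.assoc)+

lemma V_left_s: "s * v \<in> V" if "v \<in> V"
  using that
proof (rule V_left_induct)
  show "s * z ^ k \<in> V" if "k < 4" for k
    using V_right_s[OF V_basic(1)[OF that]] by (simp add: z_power_commute)
  have step: "s * (s ^ i * y) \<in> V" if "i < 4" "\<And>i. i < 4 \<Longrightarrow> s ^ i * y \<in> V" for i y
  proof (cases "i = 3")
    case True
    have "s * (s ^ i * y) = s * (s * (s * s)) * y"
      by (simp add: True power3_eq_cube mult.assoc)
    also have "\<dots> = a \<bullet> (s ^ 3 * y) + b \<bullet> (s ^ 2 * y) + c \<bullet> (s ^ 1 * y) + d \<bullet> (s ^ 0 * y)"
      by (simp add: quartics ring_distribs scale_mult power3_eq_cube power2_eq_square mult.assoc)
    also have "\<dots> \<in> V" by (intro V_closed that) simp_all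
    finally show ?thesis .
  next
    case False
    then show ?thesis using that(1) that(2)[of "i + 1"] by (simp add: mult.assoc)
  qed
  show "s * (s ^ i * (t * z ^ k)) \<in> V" if "i < 4" "k < 4" for i k
    using that by (intro step V_basic)
  show "s * (s ^ i * (t * (t * z))) \<in> V" if "i < 4" for i
    using that by (intro step V_basic)
qed

lemma V_left_s': "s' * v \<in> V" if "v \<in> V"
proof -
  have "s' * v = e \<bullet> (s * (s * (s * v)) - a \<bullet> (s * (s * v)) - b \<bullet> (s * v) - c \<bullet> v)"
    by (subst s_shift(4)) (simp add: ring_distribs scale_mult mult.assoc)
  then show ?thesis using that by (simp add: V_closed V_left_s)
qed

lemmas V_intros = V_closed V_left_s V_left_s' V_right_s V_right_s'

lemma V_t: "k < 4 \<Longrightarrow> t * z ^ k \<in> V"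
  using V_basic(2)[of 0] by simp

text \<open>Multiply t^2 = a t + b + c t^-1 + d t^-2 by z and insert the positive words for t^-1 z
  and t^-2 z.\<close>

lemma tt_z: "t * (t * z) = d \<bullet> (s * (t * (t * s))) + a \<bullet> (t * z) + b \<bullet> z + c \<bullet> (s * (s * (t * (s * s))))"
proof -
  have "t * (t * z) = (t * t) * z" by (simp add: mult.assoc)
  also have "\<dots> = a \<bullet> (t * z) + b \<bullet> z + c \<bullet> (t' * z) + d \<bullet> (t' * (t' * z))"
    by (subst t_shift(2)) (simp add: ring_distribs scale_mult mult.assoc)
  finally show ?thesis unfolding t'_z(2) by (simp add: t'_z(1) algebra_simps)
qed

text \<open>The relation \<open>tt_z\<close> raises the exponent of z; solved for t^2 it also
  reaches exponent 0 from the spanning element t^2 z.\<close>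

lemma tt_z_power_in_V: "k < 4 \<Longrightarrow> t * (t * z ^ k) \<in> V"
proof -
  have 1: "t * (t * z) \<in> V" using V_basic(3)[of 0] by simp
  have step: "t * (t * z ^ Suc k) \<in> V" if "t * (t * z ^ k) \<in> V" "Suc k < 4" for k
  proof -
    have "t * (t * z ^ Suc k) = t * (t * z) * z ^ k" by (simp add: mult.assoc)
    also have "\<dots> = d \<bullet> (s * (t * (t * z ^ k)) * s) + a \<bullet> (t * z ^ Suc k) + b \<bullet> z ^ Suc k
        + c \<bullet> (s * (s * (t * z ^ k * s * s)))"
      unfolding tt_z by (simp add: ring_distribs scale_mult mult.assoc z_power_commute z_power_left)
    also have "\<dots> \<in> V" using that V_t[of k] V_t[of "Suc k"] V_basic(1)[of "Suc k"] by (intro V_intros) auto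
    finally show ?thesis .
  qed
  have 0: "t * t \<in> V"
  proof -
    have "t * t = e \<bullet> (s' * (d \<bullet> (s * (t * (t * s)))) * s')"
      by (simp add: scale_mult e_d mult.assoc inverses_left inverses)
    also have "d \<bullet> (s * (t * (t * s))) = t * (t * z) - a \<bullet> (t * z) - b \<bullet> z - c \<bullet> (s * (s * (t * s * s)))"
      by (simp add: tt_z mult.assoc)
    also have "e \<bullet> (s' * \<dots> * s') \<in> V"
      using 1 V_t[of 0] V_t[of 1] V_basic(1)[of 1] by (intro V_intros) auto
    finally show ?thesis .
  qed
  show "k < 4 \<Longrightarrow> t * (t * z ^ k) \<in> V"
  proof (induction k)
    case (Suc k)
    then show ?case by (intro step) auto
  qed (simp add: 0)
qed

text \<open>The leading term of the expansion raises the exponent of z by one, hence k < 3.\<close>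

lemma t_s'_t_z_power_in_V: "k < 3 \<Longrightarrow> t * (s' * (t * z ^ k)) \<in> V"
proof -
  assume k: "k < 3"
  have "t * (s' * (t * z ^ k)) = t * (s' * t) * z ^ k" by (simp add: mult.assoc)
  also have "\<dots> = e \<bullet> (s' * (t * z ^ Suc k) * s' - a \<bullet> (s' * (s' * z ^ Suc k)) - b \<bullet> (s * (t * z ^ k) * s)
      - c \<bullet> (t * (t * z ^ k)))"
    unfolding t_s'_t_expand
    by (simp add: ring_distribs scale_mult mult.assoc z_left z_commute' z_power_commute z_power_left)
  also have "\<dots> \<in> V"
    using k V_t[of k] V_t[of "Suc k"] V_basic(1)[of "Suc k"] tt_z_power_in_V[of k]
    by (intro V_intros) auto
  finally show ?thesis .
qed

text \<open>A factor z turns t^-1 into a positive word. The exponent 0 has no such factor and is the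
  hard case, settled in \<open>t'_in_V\<close>.\<close>

lemma t'z_in_V: "k < 3 \<Longrightarrow> t' * z ^ Suc k \<in> V"
proof -
  assume k: "k < 3"
  have "t' * z ^ Suc k = (t' * z) * z ^ k" by (simp add: mult.assoc)
  also have "\<dots> = s * (s * (t * z ^ k * s * s))"
    by (simp add: t'_z mult.assoc z_power_commute z_power_left)
  also have "\<dots> \<in> V" using k V_t[of k] by (intro V_intros) auto
  finally show ?thesis .
qed

lemma ttt_in_V: "t * (t * (t * z ^ k)) \<in> V" if "k < 4" "t' * z ^ k \<in> V"
proof -
  have "t * (t * (t * z ^ k)) = (t * (t * t)) * z ^ k" by (simp add: mult.assoc)
  also have "\<dots> = a \<bullet> (t * (t * z ^ k)) + b \<bullet> (t * z ^ k) + c \<bullet> z ^ k + d \<bullet> (t' * z ^ k)"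
    by (subst t_shift(1)) (simp add: ring_distribs scale_mult mult.assoc)
  also have "\<dots> \<in> V" using that tt_z_power_in_V[of k] V_t[of k] V_basic(1)[of k] by (intro V_intros) auto
  finally show ?thesis .
qed

lemma tt_s'_t_z_in_V: "t * (t * (s' * (t * z))) \<in> V"
proof -
  have "t * (t * (s' * (t * z))) = t * (t * (s' * t)) * z" by (simp add: mult.assoc)
  also have "\<dots> = e \<bullet> (t * (s' * (t * z ^ 2)) * s' - a \<bullet> (t * z ^ 2 * s' * s') - b \<bullet> (s * (t * z ^ 1) * s * s)
      - c \<bullet> (t * (t * (t * z ^ 1))))"
    unfolding t_s'_t_expand
    by (simp add: ring_distribs scale_mult mult.assoc z_left z_commute z_commute' power2_eq_square
        flip: braid braid_left)
  also have "\<dots> \<in> V"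
    using t_s'_t_z_power_in_V[of 2] V_t[of 1] V_t[of 2] ttt_in_V[of 1] t'z_in_V[of 0] by (intro V_intros) auto
  finally show ?thesis .
qed

text \<open>The word \<open>t\<^sup>2 s\<inverse> t z\<close> can be rewritten in two ways: with the quartic relation of \<open>s\<close>, as in
  \<open>tt_s'_t_z_in_V\<close>, and with that of \<open>t\<close>. Comparing the results brings \<open>t\<inverse>\<close> into \<open>V\<close>.\<close>

lemma t'_in_V: "t' \<in> V"
proof -
  let ?Y = "t' * (s * (t' * z))"
  have t'z: "t' * z \<in> V" using t'z_in_V[of 0] by simp
  \<comment> \<open>By s^-1 t = t s t^-1 s^-1 the word becomes t^3 s t^-1 s^-1 z. Expanding t^3
    leaves the term with \<open>?Y\<close> as the only one not yet known to lie in V.\<close>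
  have "t * (t * (s' * (t * z))) = (t * (t * t)) * (s * (t' * (s' * z)))"
    using arg_cong[OF braid_inverses(3), of "\<lambda>w. w * z"] by (simp add: mult.assoc)
  also have "\<dots> = a \<bullet> (t * (s' * (t * z))) + b \<bullet> (s' * (t * z)) + c \<bullet> (s * (t' * z) * s') + d \<bullet> (?Y * s')"
    using arg_cong[OF braid_inverses(3), of "\<lambda>w. w * z"]
    by (subst t_shift(1)) (simp add: ring_distribs scale_mult mult.assoc z_commute')
  finally have "d \<bullet> (?Y * s') = t * (t * (s' * (t * z)))
      - (a \<bullet> (t * (s' * (t * z))) + b \<bullet> (s' * (t * z)) + c \<bullet> (s * (t' * z) * s'))" by simp
  also have "\<dots> \<in> V" using tt_s'_t_z_in_V t_s'_t_z_power_in_V[of 1] V_t[of 1] t'z by (intro V_intros) auto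
  finally have "e \<bullet> (d \<bullet> (?Y * s')) * s \<in> V" by (rule V_right_s[OF V_closed(4)])
  then have Y: "?Y \<in> V" by (simp add: e_d mult.assoc inverses scale_mult)
  \<comment> \<open>Now the middle s of \<open>?Y\<close> is expanded in powers of s^-1. The term
    with s^-3 is s t^-1 s, the only new one, and its coefficient d is a unit.\<close>
  have "?Y = a \<bullet> (t' * (t' * z)) + b \<bullet> (s' * (t' * z) * s') + c \<bullet> (s * s) + d \<bullet> (s * (t' * s))"
  proof -
    have 1: "t' * (s' * (t' * z)) = s' * (t' * z) * s'"
      using arg_cong[OF braid_inverses(5), of "\<lambda>w. w * z"] by (simp add: mult.assoc z_commute')
    have 2: "t' * (s' * (s' * (t' * z))) = s * s"
      by (simp add: t'_z inverses_left)
    have 3: "t' * (s' * (s' * (s' * (t' * z)))) = s * (t' * s)"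
      using arg_cong[OF braid_inverses(4), of "\<lambda>w. w * (s * s)"] by (simp add: t'_z inverses_left mult.assoc)
    show ?thesis
      by (subst s_shift(3)) (simp add: ring_distribs scale_mult mult.assoc 1 2 3)
  qed
  then have "d \<bullet> (s * (t' * s)) = ?Y - (a \<bullet> (s * (t * (t * z ^ 0)) * s) + b \<bullet> (s' * (t' * z) * s') + c \<bullet> (s * z ^ 0 * s))"
    by (simp add: t'_z(2) mult.assoc)
  also have "\<dots> \<in> V"
    using Y t'z tt_z_power_in_V[of 0] V_basic(1)[of 0] by (intro V_intros) auto
  finally have "s' * (e \<bullet> d \<bullet> (s * (t' * s))) * s' \<in> V"
    by (rule V_right_s'[OF V_left_s'[OF V_closed(4)]])
  then show ?thesis by (simp add: e_d mult.assoc inverses inverses_left)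
qed

text \<open>Conjugation gives t^-1 s^i t = s t^i s^-1, so only powers t^i with i at most 3 remain.
  Reducing t^3 produces t^-1 z^k, which is why t^-1 had to be placed in V first.\<close>

lemma V_left_t': "t' * v \<in> V" if "v \<in> V"
  using that
proof (rule V_left_induct)
  show t'z: "t' * z ^ k \<in> V" if "k < 4" for k
    using t'_in_V t'z_in_V[of "k - 1"] that by (cases k) auto
  have i4: "i = 0 \<or> i = 1 \<or> i = 2 \<or> i = 3" if "i < 4" for i :: nat using that by auto
  have conj: "t' * (s ^ i * t) = s * (t ^ i * s')" for i
  proof (induction i)
    case (Suc i)
    have "t' * (s ^ Suc i * t) = t' * (s * t) * (t' * (s ^ i * t))"
      by (simp add: mult.assoc inverses_left)
    then show ?case by (simp add: Suc braid_inverses(2) mult.assoc inverses_left)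
  qed (simp add: inverses)
  show "t' * (s ^ i * (t * z ^ k)) \<in> V" if "i < 4" "k < 4" for i k
  proof -
    have "t' * (s ^ i * (t * z ^ k)) = t' * (s ^ i * t) * z ^ k" by (simp add: mult.assoc)
    also have "\<dots> = s * (t ^ i * z ^ k) * s'"
      unfolding conj by (simp add: mult.assoc z_power_commute)
    finally have eq: "t' * (s ^ i * (t * z ^ k)) = s * (t ^ i * z ^ k) * s'" .
    have "t ^ i * z ^ k \<in> V"
      using i4[OF that(1)] that V_basic(1)[of k] V_t[of k] tt_z_power_in_V[of k] ttt_in_V[of k] t'z[of k]
      by (auto simp: power2_eq_square power3_eq_cube mult.assoc)
    then show ?thesis unfolding eq by (intro V_intros)
  qed
  show "t' * (s ^ i * (t * (t * z))) \<in> V" if "i < 4" for i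
  proof -
    have "t' * (s ^ i * (t * (t * z))) = t' * (s ^ i * t) * (t * z)" by (simp add: mult.assoc)
    also have "\<dots> = s * (t ^ i * (s' * (t * z)))"
      unfolding conj by (simp add: mult.assoc)
    finally have eq: "t' * (s ^ i * (t * (t * z))) = s * (t ^ i * (s' * (t * z)))" .
    have "t * (t * (t * (s' * (t * z)))) = t * (t * t) * (s' * (t * z))" by (simp add: mult.assoc)
    also have "\<dots> = a \<bullet> (t * (t * (s' * (t * z)))) + b \<bullet> (t * (s' * (t * z))) + c \<bullet> (s' * (t * z))
        + d \<bullet> (s * (t' * z) * s')"
      using arg_cong[OF braid_inverses(4), of "\<lambda>w. w * z"]
      by (subst t_shift(1)) (simp add: ring_distribs scale_mult mult.assoc z_commute')
    also have "\<dots> \<in> V"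
      using tt_s'_t_z_in_V t_s'_t_z_power_in_V[of 1] V_t[of 1] t'z[of 1] by (intro V_intros) auto
    finally have "t * (t * (t * (s' * (t * z)))) \<in> V" .
    then have "t ^ i * (s' * (t * z)) \<in> V"
      using i4[OF that] tt_s'_t_z_in_V t_s'_t_z_power_in_V[of 1] V_left_s'[OF V_t[of 1]]
      by (auto simp: power2_eq_square power3_eq_cube mult.assoc)
    then show ?thesis unfolding eq by (intro V_intros)
  qed
qed

lemma V_left_t: "t * v \<in> V" if "v \<in> V"
proof -
  have "t * v = a \<bullet> v + b \<bullet> (t' * v) + c \<bullet> (t' * (t' * v)) + d \<bullet> (t' * (t' * (t' * v)))"
    by (subst t_shift(3)) (simp add: ring_distribs scale_mult mult.assoc)
  then show ?thesis using that by (simp add: V_closed V_left_t')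
qed

lemma span_basis: "span {\<pi> (basis_elt j m) | j m. j < 24 \<and> m < 4} = UNIV"
proof -
  have "\<pi> (abs_B3 w) \<in> V" for w
  proof (induction w)
    case Nil
    then show ?case using V_basic(1)[of 0] \<pi>_0 by (simp add: zero_B3_def)
  next
    case (Cons l w)
    have "abs_B3 (l # w) = abs_B3 [l] + abs_B3 w" by (simp add: plus_B3.abs_eq)
    then have "\<pi> (abs_B3 (l # w)) = \<pi> (abs_B3 [l]) * \<pi> (abs_B3 w)" by (simp add: \<pi>_plus)
    moreover obtain g \<epsilon> where l: "l = (g, \<epsilon>)" by fastforce
    have "\<pi> (abs_B3 [l]) \<in> {s, s', t, t'}"
      unfolding l s_def s'_def t_def t'_def
      by (cases g; cases \<epsilon>) (simp_all add: braid_gen.abs_eq uminus_B3.abs_eq)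
    ultimately show ?case
      using Cons V_left_s V_left_s' V_left_t V_left_t' by auto
  qed
  then have "range \<pi> \<subseteq> V"
    by (metis Quotient_B3 Quotient_abs_rep image_subsetI)
  then have "span (range \<pi>) \<subseteq> V"
    unfolding V_def by (rule span_minimal) simp
  then show ?thesis using span_range by (auto simp: V_def)
qed

end

section \<open>Freeness and the order of the group\<close>

lemma ideal_gen_singleton_dvd: "p \<in> ideal_gen {q} \<Longrightarrow> q dvd p"
  for p q :: "'a::comm_ring_1"
  by (induction rule: ideal_gen.induct) auto

definition quartic_poly :: "'a::comm_ring_1 \<Rightarrow> 'a \<Rightarrow> 'a \<Rightarrow> 'a \<Rightarrow> 'a poly" where
  "quartic_poly a b c d = [:- d, - c, - b, - a, 1:]"

text \<open>The divisor is monic, so degrees add in the product even in the presence of zero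
  divisors.\<close>

lemma quartic_poly_dvd_cubic:
  assumes "quartic_poly a b c d dvd [:r0, r1, r2, r3:]"
  shows "r0 = 0 \<and> r1 = 0 \<and> r2 = 0 \<and> r3 = 0"
proof -
  obtain k where k: "[:r0, r1, r2, r3:] = quartic_poly a b c d * k" using assms by (elim dvdE)
  have "k = 0"
  proof (rule ccontr)
    assume "k \<noteq> 0"
    have "degree (quartic_poly a b c d) = 4" "lead_coeff (quartic_poly a b c d) = 1"
      by (simp_all add: quartic_poly_def)
    then have "coeff (quartic_poly a b c d * k) (4 + degree k) = lead_coeff k"
      using coeff_mult_degree_sum[of "quartic_poly a b c d" k] by simp
    moreover have "coeff [:r0, r1, r2, r3:] (4 + degree k) = 0" by (simp add: numeral_eq_Suc)
    ultimately show False using \<open>k \<noteq> 0\<close> by (simp add: k)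
  qed
  then show ?thesis using k by simp
qed

lemma quartic_poly_root:
  "[:0, 1:] ^ 4 - ([:a:] * [:0, 1:] ^ 3 + [:b:] * [:0, 1:] ^ 2 + [:c:] * [:0, 1:] + [:d:])
    = quartic_poly a b c d"
  by (simp add: quartic_poly_def numeral_eq_Suc)

text \<open>Nontriviality of the extension rings, demanded by the class
  \<open>comm_ring_1\<close>.\<close>

lemma one_not_in_quartic_ideal: "1 \<notin> ideal_gen {quartic_poly a b c d}"
  using ideal_gen_singleton_dvd[of 1 "quartic_poly a b c d"]
    quartic_poly_dvd_cubic[of a b c d 1 0 0 0] by (auto simp: one_pCons)

lemma cubic_sum:
  "(\<Sum>m<4. [:r m:] * [:0, 1:] ^ m) = [:r 0, r 1, r 2, r 3 :: 'a::comm_ring_1:]"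
  by (simp add: numeral_eq_Suc)

lemma (in quartic_rep) ideal_coeffs:
  assumes "(\<Sum>j<24. \<Sum>m<4. Poly_Mapping.single (basis_elt j m) (r j m)) \<in> ideal_gen (range (quartic_relator a b c d))"
    and "\<And>r. (\<Sum>m<4. \<iota> (r m) * x ^ m) = 0 \<Longrightarrow> \<forall>m<4. r m = 0"
    and "j < 24" "m < 4"
  shows "r j m = 0"
  using basis_coeffs[OF alg_act_ideal[OF assms(1)] assms(3)] assms(2)[of "r j"] assms(4)
    alg_act_relator by auto

text \<open>Independence over index pairs also excludes repetitions: two equal elements would give a
  relation with coefficients 1 and -1. Hence the set has 96 elements.\<close>

lemma (in B3_algebra) free_of_rank_96:
  assumes indep: "\<And>r j m. (\<Sum>j<24. \<Sum>m<4. r j m \<bullet> \<pi> (basis_elt j m)) = 0 \<Longrightarrow> j < 24 \<Longrightarrow> m < 4 \<Longrightarrow> r j m = 0"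
  shows "free_of_rank 96"
proof -
  let ?I = "{..<24::nat} \<times> {..<4::nat}"
  define f where "f = (\<lambda>(j, m). \<pi> (basis_elt j m))"
  have sum: "(\<Sum>i\<in>?I. u i \<bullet> f i) = (\<Sum>j<24. \<Sum>m<4. u (j, m) \<bullet> \<pi> (basis_elt j m))" for u
    by (simp add: sum.cartesian_product f_def case_prod_unfold)
  have indep': "u i = 0" if "(\<Sum>i\<in>?I. u i \<bullet> f i) = 0" "i \<in> ?I" for u i
    using indep[of "\<lambda>j m. u (j, m)" "fst i" "snd i"] that by (auto simp: sum)
  have inj: "inj_on f ?I"
  proof (rule inj_onI, rule ccontr)
    fix i k assume ik: "i \<in> ?I" "k \<in> ?I" "f i = f k" "i \<noteq> k"
    let ?u = "\<lambda>l. (if l = i then 1 else 0) - (if l = k then 1 else 0 :: 'r)"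
    have "(\<Sum>l\<in>?I. ?u l \<bullet> f l) = (\<Sum>l\<in>?I. if l = i then f l else 0) - (\<Sum>l\<in>?I. if l = k then f l else 0)"
      by (simp add: scale_left_diff_distrib sum_subtractf if_distrib[of "\<lambda>r. r \<bullet> _"] cong: if_cong)
    also have "\<dots> = 0" using ik by simp
    finally have "?u i = 0" using ik(1) by (rule indep')
    then show False using ik by simp
  qed
  have "independent (f ` ?I)"
  proof -
    have "u v = 0" if "(\<Sum>v\<in>f ` ?I. u v \<bullet> v) = 0" "v \<in> f ` ?I" for u v
      using that indep'[of "u \<circ> f"] by (auto simp: sum.reindex[OF inj])
    then show ?thesis by (subst dependent_finite) auto
  qed
  moreover have "f ` ?I = {\<pi> (basis_elt j m) | j m. j < 24 \<and> m < 4}"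
    by (auto simp: f_def)
  moreover have "finite (f ` ?I)" by simp
  ultimately show ?thesis
    unfolding free_of_rank_def using card_image[OF inj] span_basis
    by (intro exI[of _ "f ` ?I"]) simp
qed

lemma hom_sum: "is_hom h \<Longrightarrow> h (sum F K) = (\<Sum>k\<in>K. h (F k))"
  by (induction K rule: infinite_finite_induct) (simp_all add: is_homD)

text \<open>R[X] modulo the quartic, described through its projection so as to fit the quotient
  types over both coefficient rings.\<close>

locale quartic_extension =
  fixes proj :: "'r::comm_ring_1 poly \<Rightarrow> 'x::comm_ring_1" and a b c d e :: 'r
  assumes proj_hom: "is_hom proj"
    and kernel: "proj p = 0 \<longleftrightarrow> p \<in> ideal_gen {quartic_poly a b c d}"
    and unit: "d * e = 1"
begin

lemma hom_const: "is_hom (\<lambda>r. proj [:r:])"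
proof -
  have "[:1:] = (1 :: 'r poly)" "[:r + r':] = [:r:] + [:r':]" "[:r * r':] = [:r:] * [:r':]" for r r' :: 'r
    by (simp_all add: one_pCons)
  then show ?thesis by (simp only: is_hom_def is_homD[OF proj_hom]) simp
qed

sublocale quartic_rep "\<lambda>r. proj [:r:]" a b c d e "proj [:0, 1:]"
proof
  show "is_hom (\<lambda>r. proj [:r:])" by (rule hom_const)
  show "proj [:d:] * proj [:e:] = 1"
    using unit is_homD[OF hom_const] by metis
  have "proj (quartic_poly a b c d) = 0" using kernel by (blast intro: ideal_gen.incl)
  then show "proj [:0, 1:] ^ 4 = proj [:a:] * proj [:0, 1:] ^ 3 + proj [:b:] * proj [:0, 1:] ^ 2
      + proj [:c:] * proj [:0, 1:] + proj [:d:]"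
    unfolding quartic_poly_root[symmetric] is_homD[OF proj_hom] by simp
qed

lemma powers_independent:
  assumes "(\<Sum>m<4. proj [:r m:] * proj [:0, 1:] ^ m) = 0"
  shows "\<forall>m<4. r m = 0"
proof -
  have "proj (\<Sum>m<4. [:r m:] * [:0, 1:] ^ m) = 0"
    using assms by (simp only: hom_sum[OF proj_hom] is_homD[OF proj_hom])
  then have "quartic_poly a b c d dvd [:r 0, r 1, r 2, r 3:]"
    using kernel ideal_gen_singleton_dvd unfolding cubic_sum by blast
  then have "r 0 = 0 \<and> r 1 = 0 \<and> r 2 = 0 \<and> r 3 = 0" by (rule quartic_poly_dvd_cubic)
  then show ?thesis by (auto simp: less_Suc_eq numeral_eq_Suc)
qed

end

section \<open>Quotients of the group algebra by quartic relators\<close>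

lemma alg_const_commute: "alg_const r * p = p * alg_const r"
proof (induction p rule: poly_mapping_single_add_induct)
  case (single g r')
  show ?case by (simp add: alg_const_def mult_single mult.commute)
qed (simp_all add: ring_distribs)

locale quartic_quotient = module scale
  for scale :: "'r::comm_ring_1 \<Rightarrow> 'h::{ring, monoid_mult} \<Rightarrow> 'h" +
  fixes proj :: "(B3 \<Rightarrow>\<^sub>0 'r) \<Rightarrow> 'h" and a b c d e :: 'r
  assumes proj: "proj (p + q) = proj p + proj q" "proj (p * q) = proj p * proj q" "proj 1 = 1" "surj proj"
    and scale: "scale r h = proj (alg_const r) * h"
    and kernel: "proj p = 0 \<longleftrightarrow> p \<in> ideal_gen (range (quartic_relator a b c d))"
    and unit: "d * e = 1"
begin

lemma proj': "proj 0 = 0" "proj (p - q) = proj p - proj q" "proj (p ^ n) = proj p ^ n"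
  "proj (sum F K) = (\<Sum>k\<in>K. proj (F k))"
proof -
  show 0: "proj 0 = 0" by (simp add: kernel ideal_gen.zero)
  show "proj (p - q) = proj p - proj q" using proj(1)[of "p - q" q] by (simp add: eq_diff_eq)
  show "proj (p ^ n) = proj p ^ n" by (induction n) (simp_all add: proj)
  show "proj (sum F K) = (\<Sum>k\<in>K. proj (F k))"
    by (induction K rule: infinite_finite_induct) (simp_all add: proj 0)
qed

lemma proj_single: "proj (Poly_Mapping.single g r) = scale r (proj (Poly_Mapping.single g 1))"
  by (simp add: scale alg_const_def mult_single flip: proj)

sublocale B3_algebra scale "\<lambda>g. proj (Poly_Mapping.single g 1)" a b c d e
proof
  show "scale r x * y = scale r (x * y)" for r x y
    by (simp add: scale mult.assoc)
  show "x * scale r y = scale r (x * y)" for r x y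
  proof -
    obtain p where "x = proj p" using proj(4) by (metis surjD)
    then have "x * proj (alg_const r) = proj (alg_const r) * x"
      by (simp add: alg_const_commute flip: proj)
    then show ?thesis by (simp add: scale flip: mult.assoc)
  qed
  show "proj (Poly_Mapping.single 0 1) = 1" by (simp add: proj)
  show "proj (Poly_Mapping.single (g + h) 1) = proj (Poly_Mapping.single g 1) * proj (Poly_Mapping.single h 1)"
    for g h by (simp add: mult_single flip: proj)
  show "d * e = 1" by (rule unit)
  show "proj (Poly_Mapping.single (braid_gen k) 1) ^ 4 =
      scale a (proj (Poly_Mapping.single (braid_gen k) 1) ^ 3) +
      scale b (proj (Poly_Mapping.single (braid_gen k) 1) ^ 2) +
      scale c (proj (Poly_Mapping.single (braid_gen k) 1)) + scale d 1" for k
  proof -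
    have "proj (quartic_relator a b c d k) = 0"
      by (auto simp: kernel intro: ideal_gen.incl)
    then show ?thesis
      by (simp add: quartic_relator_def proj proj' scale flip: alg_gen_def)
  qed
  have "proj p \<in> span (range (\<lambda>g. proj (Poly_Mapping.single g 1)))" for p
  proof (induction p rule: poly_mapping_single_add_induct)
    case zero
    show ?case by (simp add: proj' span_zero)
  next
    case (single g r)
    show ?case by (subst proj_single) (intro span_scale span_base rangeI)
  next
    case (add p q)
    then show ?case by (simp add: proj span_add)
  qed
  then show "span (range (\<lambda>g. proj (Poly_Mapping.single g 1))) = UNIV"
    using proj(4) by (metis UNIV_eq_I surjD)
qed

text \<open>A vanishing combination lifts to the ideal of the relators, which acts by zero. Its
  coefficients then form cubics vanishing at the adjoined root, so they are zero.\<close>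

lemma free_if_extension:
  assumes "quartic_extension (ext :: 'r poly \<Rightarrow> 'x::comm_ring_1) a b c d e"
  shows "free_of_rank 96"
proof (rule free_of_rank_96)
  interpret ext: quartic_extension ext a b c d e by (rule assms)
  fix r :: "nat \<Rightarrow> nat \<Rightarrow> 'r" and j m :: nat
  assume 0: "(\<Sum>j<24. \<Sum>m<4. scale (r j m) (proj (Poly_Mapping.single (basis_elt j m) 1))) = 0"
    and jm: "j < 24" "m < 4"
  have "proj (\<Sum>j<24. \<Sum>m<4. Poly_Mapping.single (basis_elt j m) (r j m)) = 0"
    using 0 by (simp add: proj' proj_single[of _ "r _ _"])
  then show "r j m = 0" using ext.powers_independent jm
    unfolding kernel by (rule ext.ideal_coeffs)
qed

end

\<comment> \<open>Freeness of \<open>H4\<close>\<close>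
quotient_type R4_ext = "R4 poly" / "ideal_cong {quartic_poly R4_a R4_b R4_c R4_d}"
  by (rule ideal_cong_equivp)

instantiation R4_ext :: comm_ring_1
begin

lift_definition zero_R4_ext :: R4_ext is 0 .
lift_definition one_R4_ext :: R4_ext is 1 .
lift_definition plus_R4_ext :: "R4_ext \<Rightarrow> R4_ext \<Rightarrow> R4_ext" is "(+)" by (rule ideal_cong_plus)
lift_definition uminus_R4_ext :: "R4_ext \<Rightarrow> R4_ext" is uminus by (rule ideal_cong_uminus)
lift_definition minus_R4_ext :: "R4_ext \<Rightarrow> R4_ext \<Rightarrow> R4_ext" is "(-)" by (rule ideal_cong_minus)
lift_definition times_R4_ext :: "R4_ext \<Rightarrow> R4_ext \<Rightarrow> R4_ext" is "(*)" by (rule ideal_cong_times)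

instance
proof
  show "(0 :: R4_ext) \<noteq> 1"
    by transfer (use one_not_in_quartic_ideal ideal_cong_uminus in \<open>fastforce simp: ideal_cong_def\<close>)
qed (transfer, simp add: algebra_simps ideal_cong_refl)+

end

abbreviation "R4_e \<equiv> Poly_Mapping.single (0, 0, 0, - 1) 1 :: R4"

lemma R4_unit: "R4_d * R4_e = 1"
  by (simp add: R4_d_def mult_single flip: single_one) (simp add: zero_prod_def)

lemma R4_extension: "quartic_extension abs_R4_ext R4_a R4_b R4_c R4_d R4_e"
  by unfold_locales
    (simp_all add: is_hom_def one_R4_ext_def zero_R4_ext_def plus_R4_ext.abs_eq times_R4_ext.abs_eq
      R4_ext.abs_eq_iff ideal_cong_def R4_unit)

interpretation H4: quartic_quotient H4_scale abs_H4 R4_a R4_b R4_c R4_d R4_e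
proof
  show "surj abs_H4" by (metis Quotient_H4 Quotient_abs_rep surjI)
  have "range (quartic_relator R4_a R4_b R4_c R4_d) = H4_relators"
    by (simp add: H4_relators_def quartic_relator_def)
  then show "(abs_H4 p = 0) = (p \<in> ideal_gen (range (quartic_relator R4_a R4_b R4_c R4_d)))" for p
    by (simp add: zero_H4_def H4.abs_eq_iff ideal_cong_def)
qed (simp_all add: plus_H4.abs_eq times_H4.abs_eq one_H4_def H4_scale_def R4_unit)

lemma H4_free: "H4.free_of_rank 96"
  using R4_extension by (rule H4.free_if_extension)

\<comment> \<open>Freeness of the generic Hecke algebra\<close>
quotient_type R4_tilde_ext = "R4_tilde poly" / "ideal_cong {quartic_poly (u1 + u2 + u3 + u4)
    (- (u1 * u2 + u1 * u3 + u1 * u4 + u2 * u3 + u2 * u4 + u3 * u4))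
    (u1 * u2 * u3 + u1 * u2 * u4 + u1 * u3 * u4 + u2 * u3 * u4) (- (u1 * u2 * u3 * u4))}"
  by (rule ideal_cong_equivp)

instantiation R4_tilde_ext :: comm_ring_1
begin

lift_definition zero_R4_tilde_ext :: R4_tilde_ext is 0 .
lift_definition one_R4_tilde_ext :: R4_tilde_ext is 1 .
lift_definition plus_R4_tilde_ext :: "R4_tilde_ext \<Rightarrow> R4_tilde_ext \<Rightarrow> R4_tilde_ext" is "(+)"
  by (rule ideal_cong_plus)
lift_definition uminus_R4_tilde_ext :: "R4_tilde_ext \<Rightarrow> R4_tilde_ext" is uminus
  by (rule ideal_cong_uminus)
lift_definition minus_R4_tilde_ext :: "R4_tilde_ext \<Rightarrow> R4_tilde_ext \<Rightarrow> R4_tilde_ext" is "(-)"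
  by (rule ideal_cong_minus)
lift_definition times_R4_tilde_ext :: "R4_tilde_ext \<Rightarrow> R4_tilde_ext \<Rightarrow> R4_tilde_ext" is "(*)"
  by (rule ideal_cong_times)

instance
proof
  show "(0 :: R4_tilde_ext) \<noteq> 1"
    by transfer (use one_not_in_quartic_ideal ideal_cong_uminus in \<open>fastforce simp: ideal_cong_def\<close>)
qed (transfer, simp add: algebra_simps ideal_cong_refl)+

end

text \<open>The signed elementary symmetric polynomials, so that the quartic has the roots
  \<open>u1\<close>, \<open>u2\<close>, \<open>u3\<close>, \<open>u4\<close>;
  \<open>R4_tilde_e\<close> is the inverse of minus their product.\<close>

definition "R4_tilde_a = u1 + u2 + u3 + u4"
definition "R4_tilde_b = - (u1 * u2 + u1 * u3 + u1 * u4 + u2 * u3 + u2 * u4 + u3 * u4)"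
definition "R4_tilde_c = u1 * u2 * u3 + u1 * u2 * u4 + u1 * u3 * u4 + u2 * u3 * u4"
definition "R4_tilde_d = - (u1 * u2 * u3 * u4)"
definition "R4_tilde_e = - (Poly_Mapping.single (- 1, - 1, - 1, - 1) 1 :: R4_tilde)"

lemma R4_tilde_unit: "R4_tilde_d * R4_tilde_e = 1"
  by (simp add: R4_tilde_d_def R4_tilde_e_def u1_def u2_def u3_def u4_def mult_single flip: single_one)
    (simp add: zero_prod_def)

lemma R4_tilde_extension:
  "quartic_extension abs_R4_tilde_ext R4_tilde_a R4_tilde_b R4_tilde_c R4_tilde_d R4_tilde_e"
  by unfold_locales
    (simp_all add: is_hom_def one_R4_tilde_ext_def zero_R4_tilde_ext_def plus_R4_tilde_ext.abs_eq
      times_R4_tilde_ext.abs_eq R4_tilde_ext.abs_eq_iff ideal_cong_def R4_tilde_unit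
      R4_tilde_a_def R4_tilde_b_def R4_tilde_c_def R4_tilde_d_def flip: R4_tilde_d_def)

text \<open>Vieta's formulas in a noncommutative ring with central roots; the collected commutation
  rules bring every monomial into one order.\<close>

lemma quartic_expand:
  fixes g x y z w :: "'a::ring_1"
  assumes "\<And>h. x * h = h * x" "\<And>h. y * h = h * y" "\<And>h. z * h = h * z" "\<And>h. w * h = h * w"
  shows "(g - x) * (g - y) * (g - z) * (g - w) = g ^ 4 - ((x + y + z + w) * g ^ 3
    + - (x * y + x * z + x * w + y * z + y * w + z * w) * g ^ 2
    + (x * y * z + x * y * w + x * z * w + y * z * w) * g + - (x * y * z * w))"
proof -
  have c: "g * x = x * g" "g * y = y * g" "g * z = z * g" "g * w = w * g"
    "y * x = x * y" "z * x = x * z" "z * y = y * z" "w * x = x * w" "w * y = y * w" "w * z = z * w"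
    using assms by metis+
  then have "g * (x * h) = x * (g * h)" "g * (y * h) = y * (g * h)" "g * (z * h) = z * (g * h)"
    "g * (w * h) = w * (g * h)" "y * (x * h) = x * (y * h)" "z * (x * h) = x * (z * h)"
    "z * (y * h) = y * (z * h)" "w * (x * h) = x * (w * h)" "w * (y * h) = y * (w * h)"
    "w * (z * h) = z * (w * h)" for h
    by (metis mult.assoc)+
  note c this
  then show ?thesis
    by (simp add: left_diff_distrib right_diff_distrib distrib_left distrib_right mult.assoc
        power4_eq_xxxx power3_eq_cube power2_eq_square)
qed

lemma range_hecke_G8_relators:
  "hecke_G8_relators = range (quartic_relator R4_tilde_a R4_tilde_b R4_tilde_c R4_tilde_d)"
proof -
  have minus: "alg_const (- r) = - alg_const r" for r :: R4_tilde
    by (simp add: alg_const_def single_uminus)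
  show ?thesis
    unfolding hecke_G8_relators_def quartic_relator_def R4_tilde_a_def R4_tilde_b_def
      R4_tilde_c_def R4_tilde_d_def minus alg_const_simps
    by (subst quartic_expand) (rule alg_const_commute HOL.refl)+
qed

interpretation hecke_G8: quartic_quotient hecke_G8_scale abs_hecke_G8
  R4_tilde_a R4_tilde_b R4_tilde_c R4_tilde_d R4_tilde_e
proof
  show "surj abs_hecke_G8" by (metis Quotient_hecke_G8 Quotient_abs_rep surjI)
  show "(abs_hecke_G8 p = 0) =
      (p \<in> ideal_gen (range (quartic_relator R4_tilde_a R4_tilde_b R4_tilde_c R4_tilde_d)))" for p
    by (simp add: zero_hecke_G8_def hecke_G8.abs_eq_iff ideal_cong_def range_hecke_G8_relators)
qed (simp_all add: plus_hecke_G8.abs_eq times_hecke_G8.abs_eq one_hecke_G8_def hecke_G8_scale_def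
    R4_tilde_unit)

lemma hecke_G8_free: "hecke_G8.free_of_rank 96"
  using R4_tilde_extension by (rule hecke_G8.free_if_extension)

section \<open>The order of the group\<close>

lemma abs_G8_plus: "abs_G8 (g + h) = abs_G8 g + abs_G8 h"
  by (simp add: plus_G8.abs_eq)

lemma abs_G8_gen_4: "abs_G8 (braid_gen g + braid_gen g + braid_gen g + braid_gen g) = 0"
proof -
  have "G8_cong 0 (braid_gen g + braid_gen g + braid_gen g + braid_gen g)"
    unfolding G8_cong_def by (intro normal_closure.incl) auto
  then show ?thesis by (metis G8.abs_eq_iff zero_G8_def)
qed

interpretation G8_ring: B3_algebra "\<lambda>r p. Poly_Mapping.single 0 r * p"
  "\<lambda>g. Poly_Mapping.single (abs_G8 g) 1 :: G8 \<Rightarrow>\<^sub>0 int" 0 0 0 1 1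
proof
  fix r r' :: int and p q :: "G8 \<Rightarrow>\<^sub>0 int" and g h :: B3 and k :: gen
  show "Poly_Mapping.single 0 r * (p + q) = Poly_Mapping.single 0 r * p + Poly_Mapping.single 0 r * q"
    by (simp add: distrib_left)
  show "Poly_Mapping.single 0 (r + r') * p = Poly_Mapping.single 0 r * p + Poly_Mapping.single 0 r' * p"
    by (simp add: single_add distrib_right)
  show "Poly_Mapping.single 0 r * (Poly_Mapping.single 0 r' * p) = Poly_Mapping.single 0 (r * r') * p"
    by (simp add: mult_single flip: mult.assoc)
  show "Poly_Mapping.single 0 1 * p = p" by simp
  show "Poly_Mapping.single 0 r * p * q = Poly_Mapping.single 0 r * (p * q)"
    by (simp add: mult.assoc)
  have "p * Poly_Mapping.single 0 r = Poly_Mapping.single 0 r * p"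
    by (induction p rule: poly_mapping_single_add_induct)
      (simp_all add: mult_single mult.commute distrib_left distrib_right)
  then show "p * (Poly_Mapping.single 0 r * q) = Poly_Mapping.single 0 r * (p * q)"
    by (simp flip: mult.assoc)
  show "Poly_Mapping.single (abs_G8 0) 1 = (1 :: G8 \<Rightarrow>\<^sub>0 int)"
    by (simp flip: zero_G8_def)
  show "Poly_Mapping.single (abs_G8 (g + h)) (1 :: int) =
      Poly_Mapping.single (abs_G8 g) 1 * Poly_Mapping.single (abs_G8 h) 1"
    by (simp add: mult_single abs_G8_plus)
  show "(1 :: int) * 1 = 1" by simp
  have "Poly_Mapping.single (abs_G8 (braid_gen k)) (1 :: int) ^ 4 = 1"
    using abs_G8_gen_4[of k]
    by (simp add: power4_eq_xxxx mult_single abs_G8_plus add.assoc)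
  then show "Poly_Mapping.single (abs_G8 (braid_gen k)) (1 :: int) ^ 4 =
      Poly_Mapping.single 0 0 * Poly_Mapping.single (abs_G8 (braid_gen k)) 1 ^ 3 +
      Poly_Mapping.single 0 0 * Poly_Mapping.single (abs_G8 (braid_gen k)) 1 ^ 2 +
      Poly_Mapping.single 0 0 * Poly_Mapping.single (abs_G8 (braid_gen k)) 1 +
      Poly_Mapping.single 0 1 * 1"
    by simp
next
  interpret module "\<lambda>r p. Poly_Mapping.single 0 r * p :: G8 \<Rightarrow>\<^sub>0 int"
    by standard (simp_all add: single_add distrib_left distrib_right mult_single flip: mult.assoc)
  have "p \<in> span (range (\<lambda>g. Poly_Mapping.single (abs_G8 g) 1))" for p :: "G8 \<Rightarrow>\<^sub>0 int"
  proof (induction p rule: poly_mapping_single_add_induct)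
    case zero
    show ?case by (rule span_zero)
  next
    case (single x r)
    have "Poly_Mapping.single x r = Poly_Mapping.single 0 r * Poly_Mapping.single (abs_G8 (rep_G8 x)) 1"
      by (metis Quotient_G8 Quotient_abs_rep add_0_left mult.right_neutral mult_single)
    then show ?case by (auto intro: span_scale span_base)
  next
    case (add p q)
    then show ?case by (rule span_add)
  qed
  then show "span (range (\<lambda>g. Poly_Mapping.single (abs_G8 g) 1)) = UNIV" by auto
qed

text \<open>Elements of the group ring supported on the listed group elements form a submodule
  containing the spanning set, hence everything. The support of a single group element then lies in
  the list.\<close>

lemma UNIV_G8: "UNIV = (\<lambda>(j, m). abs_G8 (basis_elt j m)) ` ({..<24} \<times> {..<4})" (is "_ = ?X")
proof -
  let ?S = "{p :: G8 \<Rightarrow>\<^sub>0 int. Poly_Mapping.keys p \<subseteq> ?X}"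
  have "G8_ring.subspace ?S"
  proof (rule G8_ring.subspaceI)
    fix p q :: "G8 \<Rightarrow>\<^sub>0 int" assume "p \<in> ?S" "q \<in> ?S"
    then show "p + q \<in> ?S" using Poly_Mapping.keys_add[of p q] by auto
  next
    fix r :: int and p :: "G8 \<Rightarrow>\<^sub>0 int" assume "p \<in> ?S"
    then show "Poly_Mapping.single 0 r * p \<in> ?S"
      using keys_mult[of "Poly_Mapping.single 0 r" p] by (auto split: if_splits)
  qed simp
  then have "G8_ring.span {Poly_Mapping.single (abs_G8 (basis_elt j m)) 1 | j m. j < 24 \<and> m < 4} \<subseteq> ?S"
    by (intro G8_ring.span_minimal) auto
  then have "Poly_Mapping.keys (Poly_Mapping.single x (1 :: int)) \<subseteq> ?X" for x :: G8
    unfolding G8_ring.span_basis by blast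
  then have "x \<in> ?X" for x :: G8
    using keys_single[of x "1 :: int"] by (metis insert_subset zero_neq_one)
  then show ?thesis by blast
qed

interpretation complex_rep: quartic_root 0 0 0 1 1 \<i>
  by standard (simp_all add: power4_eq_xxxx)

text \<open>For a = b = c = 0 and d = 1 the quartic relation says that fourth powers of the
  generators act trivially, and acting trivially passes to the normal closure.\<close>

lemma complex_rep_factors: "abs_G8 g = abs_G8 h \<Longrightarrow> complex_rep.act g v = complex_rep.act h v"
proof -
  have inv: "complex_rep.act (- g) (complex_rep.act g v) = v" "complex_rep.act g (complex_rep.act (- g) v) = v" for g v
    by (simp_all add: complex_rep.act_0 flip: complex_rep.act_plus)
  have "complex_rep.act x v = v"
    if "x \<in> normal_closure (range (\<lambda>g. braid_gen g + braid_gen g + braid_gen g + braid_gen g))" for x v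
    using that
  proof (induction arbitrary: v rule: normal_closure.induct)
    case (incl x)
    then obtain k where "x = braid_gen k + braid_gen k + braid_gen k + braid_gen k" by auto
    then show ?case
      by (cases k) (simp_all add: complex_rep.act_plus complex_rep.act_gen complex_rep.S_quartic
          complex_rep.T_quartic)
  next
    case (uminus x)
    then show ?case using inv(1) by metis
  qed (simp_all only: complex_rep.act_0 complex_rep.act_plus inv)
  moreover assume "abs_G8 g = abs_G8 h"
  then have "- g + h \<in> normal_closure (range (\<lambda>g. braid_gen g + braid_gen g + braid_gen g + braid_gen g))"
    by (simp add: G8.abs_eq_iff G8_cong_def)
  ultimately have "complex_rep.act (- g + h) v = v" by blast
  then have "complex_rep.act g (complex_rep.act (- g + h) v) = complex_rep.act g v" by simp
  then show ?thesis by (simp add: add.assoc[symmetric] flip: complex_rep.act_plus)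
qed

lemma card_G8: "CARD(G8) = 96"
proof -
  have "inj_on (\<lambda>(j, m). abs_G8 (basis_elt j m)) ({..<24} \<times> {..<4})"
  proof (rule inj_onI, clarify)
    fix j m j' m' :: nat
    assume *: "j < 24" "m < 4" "j' < 24" "m' < 4" "abs_G8 (basis_elt j m) = abs_G8 (basis_elt j' m')"
    then have eq: "smul (\<i> ^ m) (unit j) = smul (\<i> ^ m') (unit j' :: complex vec24)"
      using complex_rep_factors[OF *(5), of "unit 0"] by (simp add: complex_rep.act_basis_elt)
    \<comment> \<open>Coordinate \<open>j\<close> of both sides. Powers of \<i> are nonzero, which
      forces j = j', and its first four powers are distinct.\<close>
    have "\<i> ^ m = (if j = j' then \<i> ^ m' else 0)"
      using fun_cong[OF eq, of "idx_of_nat j"] * by (simp add: smul_def unit_def idx_of_nat_inverse split: if_splits)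
    then have j: "j = j'" and "\<i> ^ m = \<i> ^ m'" by (auto split: if_splits)
    moreover have "m = 0 \<or> m = 1 \<or> m = 2 \<or> m = 3" "m' = 0 \<or> m' = 1 \<or> m' = 2 \<or> m' = 3"
      using *(2,4) by auto
    ultimately have "m = m'"
      by (elim disjE) (simp_all add: power3_eq_cube complex_eq_iff)
    with j show "j = j' \<and> m = m'" by simp
  qed
  then have "card ((\<lambda>(j, m). abs_G8 (basis_elt j m)) ` ({..<24::nat} \<times> {..<4::nat})) = 96"
    by (simp add: card_image)
  then show ?thesis by (simp flip: UNIV_G8)
qed

theorem corollary2p2p4:
  shows "H4.free_of_rank 96 \<and> CARD(G8) = 96 \<and> hecke_G8.free_of_rank CARD(G8)"
  using H4_free hecke_G8_free by (simp add: card_G8)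

end
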